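(* Let $G$ be any one of the following Polish groups: - $U(\ell^2)$, the unitary group of $\ell^2$, with the strong operator topology; - $S_\infty$, the group of all self-bijections of a countably infinite set $\omega$, with the topology of pointwise convergence on discrete $\omega$; - $\mathrm{Iso}(\mathbb{U}_1)$, with the topology of pointwise convergence; - $\mathrm{Homeo}_+[0,1]$, the group of endpoint-preserving homeomorphisms of $[0,1]$, with the compact-open topology. Then there is an element $z$ of the left completion $\hat G^L$ whose stabilizer $\{g\in G: gz=z\}$ is non-compact, and therefore $G$ admits neither proper nor free continuous isometric actions on a non-empty complete metric space (in particular, neither proper nor free continuous affine isometric actions on a Banach space).
   Context: The left completion $\hat G^L$ of a topological group $G$ is the completion of $G$ with respect to the left uniform structure, whose basic entourages are $V_L=\{(g,h): g^{-1}h\in V\}$, $V$ a neighbourhood of the identity. (If $G$ is metrizable, it is the completion with respect to any compatible left-invariant metric.) The multiplication of $G$ extends to a jointly continuous multiplication making $\hat G^L$ a topological semigroup containing $G$; $G$ acts on $\hat G^L$ by left multiplication. $\mathbb{U}_1$ is a sphere in the universal Urysohn metric space $\mathbb{U}$, namely the sphere of radius $1/2$; equivalently, it is the unique (up to isometry) complete separable metric space of diameter $1$ that contains an isometric copy of every separable metric space of diameter at most $1$ and in which every isometry between finite subspaces extends to a surjective self-isometry. $\mathrm{Iso}(X)$ is the group of all surjective self-isometries of $X$. An isometric action of $G$ on $X$ is continuous if $G\times X\to X$ is jointly continuous. An action is free if $gx=x$ for some $x\in X$ implies $g=e$. An action is (topologically) proper if the inverse images of compact sets under the map $G\times X\to X\times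 X$, $(g,x)\mapsto (gx,x)$, are compact; in particular all point stabilizers of a proper action are compact. *)

theory Defs
  imports "HOL-Analysis.Analysis" "HOL-Algebra.Group_Action"
begin

section \<open>Left completion\<close>

text \<open>
  A topological group is given by a group \<open>G\<close> and a topology \<open>T\<close> with \<open>topspace T = carrier G\<close>.
  The completion of the left uniform structure is realised as the set of minimal Cauchy filters
  (Bourbaki's Hausdorff completion).  In the filter order of the library, \<open>F \<le> F'\<close>
  means that \<open>F\<close> is finer, so a Cauchy filter with as few members as possible is maximal
  for \<open>\<le>\<close>.
\<close>

definition left_uniformity :: "('g, 'b) monoid_scheme \<Rightarrow> 'g topology \<Rightarrow> ('g \<times> 'g) filter" where
  "left_uniformity G T =
     (INF V \<in> {V. openin T V \<and> \<one>\<^bsub>G\<^esub> \<in> V}.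
        principal {(g, h) \<in> carrier G \<times> carrier G. inv\<^bsub>G\<^esub> g \<otimes>\<^bsub>G\<^esub> h \<in> V})"

definition left_cauchy :: "('g, 'b) monoid_scheme \<Rightarrow> 'g topology \<Rightarrow> 'g filter \<Rightarrow> bool" where
  "left_cauchy G T F \<longleftrightarrow>
     F \<noteq> bot \<and> F \<le> principal (carrier G) \<and> F \<times>\<^sub>F F \<le> left_uniformity G T"

definition left_completion :: "('g, 'b) monoid_scheme \<Rightarrow> 'g topology \<Rightarrow> 'g filter set" where
  "left_completion G T =
     {F. left_cauchy G T F \<and> (\<forall>F'. left_cauchy G T F' \<and> F \<le> F' \<longrightarrow> F' = F)}"

text \<open>
  Left multiplication by \<open>g\<close> is an automorphism of the left uniform structure, and its unique
  continuous extension to the completion takes a minimal Cauchy filter to its image filter.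
  An element \<open>h\<close> of \<open>G\<close> is identified with its neighbourhood filter \<open>nhdsin T h\<close>.
\<close>

definition left_mult_action ::
    "('g, 'b) monoid_scheme \<Rightarrow> 'g topology \<Rightarrow> 'g \<Rightarrow> 'g filter \<Rightarrow> 'g filter" where
  "left_mult_action G T g = (\<lambda>z \<in> left_completion G T. filtermap (\<lambda>h. g \<otimes>\<^bsub>G\<^esub> h) z)"

definition has_noncompact_stabilizer :: "('g, 'b) monoid_scheme \<Rightarrow> 'g topology \<Rightarrow> bool" where
  "has_noncompact_stabilizer G T \<longleftrightarrow>
     (\<exists>z \<in> left_completion G T. \<not> compactin T (stabilizer G (left_mult_action G T) z))"

lemma filtermap_eventually_cong:
  assumes "\<forall>\<^sub>F x in F. f x = g x"
  shows "filtermap f F = filtermap g F"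
proof -
  have "eventually (\<lambda>x. P (f x)) F = eventually (\<lambda>x. P (g x)) F" for P
    by (rule eventually_cong) (use assms in \<open>auto elim: eventually_mono\<close>)
  then show ?thesis
    by (simp add: filter_eq_iff eventually_filtermap)
qed

context group
begin

lemma filtermap_mult_mult:
  assumes "F \<le> principal (carrier G)" "g \<in> carrier G" "h \<in> carrier G"
  shows "filtermap (\<lambda>x. g \<otimes> x) (filtermap (\<lambda>x. h \<otimes> x) F) = filtermap (\<lambda>x. (g \<otimes> h) \<otimes> x) F"
  unfolding filtermap_filtermap
proof (rule filtermap_eventually_cong)
  have "eventually (\<lambda>x. x \<in> carrier G) F"
    using assms(1) by (simp add: le_principal)
  then show "\<forall>\<^sub>F x in F. g \<otimes> (h \<otimes> x) = g \<otimes> h \<otimes> x"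
    by eventually_elim (simp add: assms m_assoc)
qed

lemma filtermap_one_mult:
  assumes "F \<le> principal (carrier G)"
  shows "filtermap (\<lambda>x. \<one> \<otimes> x) F = F"
proof -
  have "eventually (\<lambda>x. x \<in> carrier G) F"
    using assms(1) by (simp add: le_principal)
  then have "\<forall>\<^sub>F x in F. \<one> \<otimes> x = id x"
    by eventually_elim simp
  then have "filtermap (\<lambda>x. \<one> \<otimes> x) F = filtermap id F"
    by (rule filtermap_eventually_cong)
  then show ?thesis
    by (simp add: id_def filtermap_ident)
qed

lemma left_cauchy_translate:
  assumes F: "left_cauchy G T F" and g: "g \<in> carrier G"
  shows "left_cauchy G T (filtermap (\<lambda>x. g \<otimes> x) F)"
proof -
  have ne: "filtermap (\<lambda>x. g \<otimes> x) F \<noteq> bot"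
    using F by (simp add: left_cauchy_def filtermap_bot_iff)
  have ev: "eventually (\<lambda>x. x \<in> carrier G) F"
    using F by (simp add: left_cauchy_def le_principal)
  have sub: "filtermap (\<lambda>x. g \<otimes> x) F \<le> principal (carrier G)"
    unfolding le_principal eventually_filtermap
    using ev by eventually_elim (simp add: g)
  have "filtermap (\<lambda>x. g \<otimes> x) F \<times>\<^sub>F filtermap (\<lambda>x. g \<otimes> x) F
          \<le> principal {(a, b) \<in> carrier G \<times> carrier G. inv a \<otimes> b \<in> V}"
    if V: "openin T V" "\<one> \<in> V" for V
  proof -
    have "F \<times>\<^sub>F F \<le> principal {(a, b) \<in> carrier G \<times> carrier G. inv a \<otimes> b \<in> V}"
      using F V unfolding left_cauchy_def left_uniformity_def le_INF_iff by auto
    then have *: "\<forall>\<^sub>F p in F \<times>\<^sub>F F. p \<in> {(a, b) \<in> carrier G \<times> carrier G. inv a \<otimes> b \<in> V}"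
      unfolding le_principal .
    have eq: "inv (g \<otimes> a) \<otimes> (g \<otimes> b) = inv a \<otimes> b"
      if "a \<in> carrier G" "b \<in> carrier G" for a b
      by (metis g that inv_closed inv_mult_group inv_solve_left' m_assoc m_closed)
    have "\<forall>\<^sub>F p in F \<times>\<^sub>F F. (g \<otimes> fst p, g \<otimes> snd p)
            \<in> {(a, b) \<in> carrier G \<times> carrier G. inv a \<otimes> b \<in> V}"
      using * by eventually_elim (auto simp: eq g)
    then show ?thesis
      unfolding prod_filtermap1 prod_filtermap2 le_principal eventually_filtermap
      by (simp add: apfst_def apsnd_def map_prod_def case_prod_beta)
  qed
  then show ?thesis
    using ne sub unfolding left_cauchy_def left_uniformity_def by (auto intro: INF_greatest)
qed

lemma left_completion_translate:
  assumes z: "z \<in> left_completion G T" and g: "g \<in> carrier G"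
  shows "filtermap (\<lambda>x. g \<otimes> x) z \<in> left_completion G T"
proof -
  have zc: "left_cauchy G T z"
    using z by (simp add: left_completion_def)
  have "F' = filtermap (\<lambda>x. g \<otimes> x) z"
    if F': "left_cauchy G T F'" and le: "filtermap (\<lambda>x. g \<otimes> x) z \<le> F'" for F'
  proof -
    have p: "F' \<le> principal (carrier G)" "z \<le> principal (carrier G)"
      using F' zc by (auto simp: left_cauchy_def)
    have "filtermap (\<lambda>x. inv g \<otimes> x) (filtermap (\<lambda>x. g \<otimes> x) z) \<le> filtermap (\<lambda>x. inv g \<otimes> x) F'"
      by (rule filtermap_mono[OF le])
    then have "z \<le> filtermap (\<lambda>x. inv g \<otimes> x) F'"
      using filtermap_mult_mult[OF p(2), of "inv g" g] filtermap_one_mult[OF p(2)] g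
      by (simp add: l_inv)
    then have "filtermap (\<lambda>x. inv g \<otimes> x) F' = z"
      using z left_cauchy_translate[OF F'] g unfolding left_completion_def by blast
    then have "filtermap (\<lambda>x. g \<otimes> x) z = filtermap (\<lambda>x. g \<otimes> x) (filtermap (\<lambda>x. inv g \<otimes> x) F')"
      by simp
    also have "\<dots> = F'"
      using filtermap_mult_mult[OF p(1), of g "inv g"] filtermap_one_mult[OF p(1)] g
      by (simp add: r_inv)
    finally show ?thesis by simp
  qed
  then show ?thesis
    using left_cauchy_translate[OF zc g] by (auto simp: left_completion_def)
qed

lemma group_action_left_mult_action:
  "group_action G (left_completion G T) (left_mult_action G T)"
proof -
  let ?C = "left_completion G T"
  have p: "z \<le> principal (carrier G)" if "z \<in> ?C" for z
    using that by (auto simp: left_completion_def left_cauchy_def)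
  have inv1: "filtermap (\<lambda>x. inv g \<otimes> x) (filtermap (\<lambda>x. g \<otimes> x) z) = z"
    and inv2: "filtermap (\<lambda>x. g \<otimes> x) (filtermap (\<lambda>x. inv g \<otimes> x) z) = z"
    if "g \<in> carrier G" "z \<in> ?C" for g z
    using that p[of z] by (auto simp: filtermap_mult_mult filtermap_one_mult)
  have bij: "left_mult_action G T g \<in> Bij ?C" if g: "g \<in> carrier G" for g
  proof -
    have "bij_betw (filtermap (\<lambda>x. g \<otimes> x)) ?C ?C"
      by (rule bij_betw_byWitness[where f' = "filtermap (\<lambda>x. inv g \<otimes> x)"])
        (use g inv1 inv2 left_completion_translate in auto)
    then have "bij_betw (left_mult_action G T g) ?C ?C"
      by (rule bij_betw_cong[THEN iffD1, rotated]) (simp add: left_mult_action_def)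
    then show ?thesis
      by (simp add: Bij_def left_mult_action_def)
  qed
  have "left_mult_action G T (g \<otimes> h) =
        compose ?C (left_mult_action G T g) (left_mult_action G T h)"
    if "g \<in> carrier G" "h \<in> carrier G" for g h
    using that p left_completion_translate
    by (auto simp: left_mult_action_def compose_def fun_eq_iff restrict_def filtermap_mult_mult)
  then have "left_mult_action G T \<in> hom G (BijGroup ?C)"
    using bij by (auto simp: hom_def BijGroup_def)
  then show ?thesis
    unfolding group_action_def group_hom_def group_hom_axioms_def
    using group_BijGroup is_group by blast
qed

end


section \<open>Isometric actions\<close>

definition continuous_isometric_action ::
    "('g, 'b) monoid_scheme \<Rightarrow> 'g topology \<Rightarrow> 'x metric \<Rightarrow> ('g \<Rightarrow> 'x \<Rightarrow> 'x) \<Rightarrow> bool" where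
  "continuous_isometric_action G T X \<phi> \<longleftrightarrow>
     group_action G (mspace X) \<phi> \<and>
     (\<forall>g \<in> carrier G. \<forall>x \<in> mspace X. \<forall>y \<in> mspace X. mdist X (\<phi> g x) (\<phi> g y) = mdist X x y) \<and>
     continuous_map (prod_topology T (mtopology_of X)) (mtopology_of X) (\<lambda>(g, x). \<phi> g x)"

definition free_action :: "('g, 'b) monoid_scheme \<Rightarrow> 'x set \<Rightarrow> ('g \<Rightarrow> 'x \<Rightarrow> 'x) \<Rightarrow> bool" where
  "free_action G E \<phi> \<longleftrightarrow> (\<forall>g \<in> carrier G. \<forall>x \<in> E. \<phi> g x = x \<longrightarrow> g = \<one>\<^bsub>G\<^esub>)"

definition proper_action ::
    "('g, 'b) monoid_scheme \<Rightarrow> 'g topology \<Rightarrow> 'x topology \<Rightarrow> ('g \<Rightarrow> 'x \<Rightarrow> 'x) \<Rightarrow> bool" where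
  "proper_action G T Y \<phi> \<longleftrightarrow>
     (\<forall>K. compactin (prod_topology Y Y) K \<longrightarrow>
        compactin (prod_topology T Y)
          {(g, x) \<in> carrier G \<times> topspace Y. (\<phi> g x, x) \<in> K})"

definition affine_action ::
    "('g, 'b) monoid_scheme \<Rightarrow> ('g \<Rightarrow> 'v::real_vector \<Rightarrow> 'v) \<Rightarrow> bool" where
  "affine_action G \<phi> \<longleftrightarrow> (\<forall>g \<in> carrier G. \<exists>L b. linear L \<and> \<phi> g = (\<lambda>x. L x + b))"

text \<open>
  The type argument is the type over which the carrier set of the metric space ranges;
  a statement with a free type variable there covers all complete metric spaces.
\<close>

definition no_proper_or_free_isometric_action ::
    "('g, 'b) monoid_scheme \<Rightarrow> 'g topology \<Rightarrow> 'x itself \<Rightarrow> bool" where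
  "no_proper_or_free_isometric_action G T (_ :: 'x itself) \<longleftrightarrow>
     (\<forall>(X :: 'x metric) \<phi>.
        mspace X \<noteq> {} \<and> mcomplete_of X \<and> continuous_isometric_action G T X \<phi> \<longrightarrow>
        \<not> proper_action G T (mtopology_of X) \<phi> \<and> \<not> free_action G (mspace X) \<phi>)"

definition no_proper_or_free_affine_isometric_action ::
    "('g, 'b) monoid_scheme \<Rightarrow> 'g topology \<Rightarrow> 'v::banach itself \<Rightarrow> bool" where
  "no_proper_or_free_affine_isometric_action G T (_ :: 'v itself) \<longleftrightarrow>
     (\<forall>\<phi> :: 'g \<Rightarrow> 'v \<Rightarrow> 'v.
        continuous_isometric_action G T euclidean_metric \<phi> \<and> affine_action G \<phi> \<longrightarrow>
        \<not> proper_action G T euclidean \<phi> \<and> \<not> free_action G UNIV \<phi>)"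


section \<open>The groups\<close>

text \<open>All four are groups of bijections of a set \<open>S\<close>, represented by extensional functions.\<close>

abbreviation perm_group :: "'a set \<Rightarrow> ('a \<Rightarrow> 'a) set \<Rightarrow> ('a \<Rightarrow> 'a) monoid" where
  "perm_group S H \<equiv> BijGroup S\<lparr>carrier := H\<rparr>"

definition pointwise_topology :: "'a topology \<Rightarrow> ('a \<Rightarrow> 'a) set \<Rightarrow> ('a \<Rightarrow> 'a) topology" where
  "pointwise_topology Y H = subtopology (product_topology (\<lambda>_. Y) (topspace Y)) H"

definition compact_open_topology :: "'a topology \<Rightarrow> ('a \<Rightarrow> 'a) set \<Rightarrow> ('a \<Rightarrow> 'a) topology" where
  "compact_open_topology Y H =
     topology_generated_by {{f \<in> H. f ` K \<subseteq> U} | K U. compactin Y K \<and> openin Y U}"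

lemma group_perm_group:
  assumes "H \<subseteq> Bij S" "(\<lambda>x\<in>S. x) \<in> H"
    and "\<And>f g. f \<in> H \<Longrightarrow> g \<in> H \<Longrightarrow> compose S f g \<in> H"
    and "\<And>f. f \<in> H \<Longrightarrow> restrict (inv_into S f) S \<in> H"
  shows "group (perm_group S H)"
proof -
  have inv: "inv\<^bsub>BijGroup S\<^esub> f = restrict (inv_into S f) S" if "f \<in> H" for f
    using that assms(1) inv_BijGroup by blast
  have "subgroup H (BijGroup S)"
    by (rule group.subgroupI[OF group_BijGroup])
      (use assms in \<open>auto simp: inv, auto simp: BijGroup_def subset_iff\<close>)
  then show ?thesis
    by (rule group.subgroup_imp_group[OF group_BijGroup])
qed


subsection \<open>The unitary group of complex \<open>\<ell>\<^sup>2\<close>\<close>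

definition ell2 :: "(nat \<Rightarrow> complex) set" where
  "ell2 = {x. (\<lambda>n. (cmod (x n))\<^sup>2) summable_on UNIV}"

definition ell2_inner :: "(nat \<Rightarrow> complex) \<Rightarrow> (nat \<Rightarrow> complex) \<Rightarrow> complex" where
  "ell2_inner x y = (\<Sum>\<^sub>\<infinity>n. x n * cnj (y n))"

definition ell2_norm :: "(nat \<Rightarrow> complex) \<Rightarrow> real" where
  "ell2_norm x = sqrt (\<Sum>\<^sub>\<infinity>n. (cmod (x n))\<^sup>2)"

definition ell2_metric :: "(nat \<Rightarrow> complex) metric" where
  "ell2_metric = metric (ell2, \<lambda>x y. ell2_norm (\<lambda>n. x n - y n))"

definition unitary_ops :: "((nat \<Rightarrow> complex) \<Rightarrow> nat \<Rightarrow> complex) set" where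
  "unitary_ops = {U \<in> Bij ell2.
     (\<forall>x \<in> ell2. \<forall>y \<in> ell2. U (\<lambda>n. x n + y n) = (\<lambda>n. U x n + U y n)) \<and>
     (\<forall>c. \<forall>x \<in> ell2. U (\<lambda>n. c * x n) = (\<lambda>n. c * U x n)) \<and>
     (\<forall>x \<in> ell2. \<forall>y \<in> ell2. ell2_inner (U x) (U y) = ell2_inner x y)}"

definition unitary_group :: "((nat \<Rightarrow> complex) \<Rightarrow> nat \<Rightarrow> complex) monoid" where
  "unitary_group = perm_group ell2 unitary_ops"

text \<open>The strong operator topology is pointwise convergence in norm.\<close>

definition unitary_strong_topology :: "((nat \<Rightarrow> complex) \<Rightarrow> nat \<Rightarrow> complex) topology" where
  "unitary_strong_topology = pointwise_topology (mtopology_of ell2_metric) unitary_ops"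

lemma ell2_scale: "x \<in> ell2 \<Longrightarrow> (\<lambda>n. c * x n) \<in> ell2"
  by (simp add: ell2_def norm_mult power_mult_distrib summable_on_cmult_right)

lemma ell2_add:
  assumes "x \<in> ell2" "y \<in> ell2" shows "(\<lambda>n. x n + y n) \<in> ell2"
proof -
  have "(\<lambda>n. 2 * (cmod (x n))\<^sup>2 + 2 * (cmod (y n))\<^sup>2) summable_on UNIV"
    using assms by (intro summable_on_add summable_on_cmult_right) (auto simp: ell2_def)
  moreover have "(cmod (x n + y n))\<^sup>2 \<le> 2 * (cmod (x n))\<^sup>2 + 2 * (cmod (y n))\<^sup>2" for n
  proof -
    have "(cmod (x n + y n))\<^sup>2 \<le> (cmod (x n) + cmod (y n))\<^sup>2"
      by (intro power_mono norm_triangle_ineq) auto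
    also have "\<dots> \<le> 2 * (cmod (x n))\<^sup>2 + 2 * (cmod (y n))\<^sup>2"
      using zero_le_power2[of "cmod (x n) - cmod (y n)"]
      by (simp add: power2_sum power2_diff)
    finally show ?thesis .
  qed
  ultimately have "(\<lambda>n. (cmod (x n + y n))\<^sup>2) summable_on UNIV"
    by (rule summable_on_comparison_test) auto
  then show ?thesis by (simp add: ell2_def)
qed

lemma ell2_diff: "x \<in> ell2 \<Longrightarrow> y \<in> ell2 \<Longrightarrow> (\<lambda>n. x n - y n) \<in> ell2"
  using ell2_add[OF _ ell2_scale[of y "-1"], of x] by simp

lemma ell2_norm_nonneg: "0 \<le> ell2_norm x"
  by (simp add: ell2_norm_def infsum_nonneg)

lemma ell2_norm_triangle:
  assumes x: "x \<in> ell2" and y: "y \<in> ell2"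
  shows "ell2_norm (\<lambda>n. x n + y n) \<le> ell2_norm x + ell2_norm y"
proof -
  have fin: "L2_set (\<lambda>n. cmod (z n)) F \<le> ell2_norm z" if "z \<in> ell2" "finite F" for z F
    unfolding L2_set_def ell2_norm_def
    by (intro real_sqrt_le_mono finite_sum_le_infsum) (use that in \<open>auto simp: ell2_def\<close>)
  have "(\<Sum>\<^sub>\<infinity>n. (cmod (x n + y n))\<^sup>2) \<le> (ell2_norm x + ell2_norm y)\<^sup>2"
  proof (rule infsum_le_finite_sums)
    show "(\<lambda>n. (cmod (x n + y n))\<^sup>2) summable_on UNIV"
      using ell2_add[OF x y] by (simp add: ell2_def)
    fix F :: "nat set" assume F: "finite F"
    have "L2_set (\<lambda>n. cmod (x n + y n)) F \<le> L2_set (\<lambda>n. cmod (x n) + cmod (y n)) F"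
      by (rule L2_set_mono) (auto intro: norm_triangle_ineq)
    also have "\<dots> \<le> L2_set (\<lambda>n. cmod (x n)) F + L2_set (\<lambda>n. cmod (y n)) F"
      by (rule L2_set_triangle_ineq)
    also have "\<dots> \<le> ell2_norm x + ell2_norm y"
      using fin[OF x F] fin[OF y F] by simp
    finally have "(L2_set (\<lambda>n. cmod (x n + y n)) F)\<^sup>2 \<le> (ell2_norm x + ell2_norm y)\<^sup>2"
      by (intro power_mono) auto
    then show "(\<Sum>n\<in>F. (cmod (x n + y n))\<^sup>2) \<le> (ell2_norm x + ell2_norm y)\<^sup>2"
      by (simp add: L2_set_def sum_nonneg)
  qed
  then have "ell2_norm (\<lambda>n. x n + y n) \<le> sqrt ((ell2_norm x + ell2_norm y)\<^sup>2)"
    unfolding ell2_norm_def by (rule real_sqrt_le_mono)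
  then show ?thesis
    using ell2_norm_nonneg[of x] ell2_norm_nonneg[of y] by simp
qed

lemma Metric_space_ell2: "Metric_space ell2 (\<lambda>x y. ell2_norm (\<lambda>n. x n - y n))"
proof
  fix x y z :: "nat \<Rightarrow> complex"
  show "0 \<le> ell2_norm (\<lambda>n. x n - y n)" by (rule ell2_norm_nonneg)
  show "ell2_norm (\<lambda>n. x n - y n) = ell2_norm (\<lambda>n. y n - x n)"
    by (simp add: ell2_norm_def norm_minus_commute)
  assume x: "x \<in> ell2" and y: "y \<in> ell2"
  have s: "(\<lambda>n. (cmod (x n - y n))\<^sup>2) summable_on UNIV"
    using ell2_diff[OF x y] by (simp add: ell2_def)
  show "ell2_norm (\<lambda>n. x n - y n) = 0 \<longleftrightarrow> x = y"
  proof
    assume "ell2_norm (\<lambda>n. x n - y n) = 0"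
    then have "(\<Sum>\<^sub>\<infinity>n. (cmod (x n - y n))\<^sup>2) = 0"
      by (simp add: ell2_norm_def)
    then have "(cmod (x n - y n))\<^sup>2 = 0" for n
      using nonneg_infsum_le_0D[OF _ s, of n] by auto
    then show "x = y" by auto
  qed (simp add: ell2_norm_def)
  assume z: "z \<in> ell2"
  show "ell2_norm (\<lambda>n. x n - z n) \<le> ell2_norm (\<lambda>n. x n - y n) + ell2_norm (\<lambda>n. y n - z n)"
    using ell2_norm_triangle[OF ell2_diff[OF x y] ell2_diff[OF y z]] by simp
qed

lemma Bij_mem: "f \<in> Bij S \<Longrightarrow> x \<in> S \<Longrightarrow> f x \<in> S"
  by (auto simp: Bij_def bij_betw_def)

lemma Bij_inv:
  assumes "f \<in> Bij S" "x \<in> S"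
  shows "inv_into S f x \<in> S" "f (inv_into S f x) = x" "inv_into S f (f x) = x"
  using assms by (auto simp: Bij_def bij_betw_def inv_into_into f_inv_into_f inv_into_f_f)

lemma Bij_inv_eqI: "f \<in> Bij S \<Longrightarrow> x \<in> S \<Longrightarrow> f x = y \<Longrightarrow> inv_into S f y = x"
  using Bij_inv(3) by fastforce

lemma group_unitary_group: "group unitary_group"
  unfolding unitary_group_def
proof (rule group_perm_group)
  show "unitary_ops \<subseteq> Bij ell2" by (auto simp: unitary_ops_def)
  show "(\<lambda>x\<in>ell2. x) \<in> unitary_ops"
    by (auto simp: unitary_ops_def id_Bij ell2_add ell2_scale)
next
  fix f g assume "f \<in> unitary_ops" "g \<in> unitary_ops"
  then show "compose ell2 f g \<in> unitary_ops"
    by (auto simp: unitary_ops_def compose_Bij compose_def ell2_add ell2_scale Bij_mem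
        intro: restrict_extensional)
      (auto simp: compose_Bij[unfolded compose_def])
next
  fix f assume f: "f \<in> unitary_ops"
  then have B: "f \<in> Bij ell2" by (simp add: unitary_ops_def)
  note i = Bij_inv[OF B]
  have "inv_into ell2 f (\<lambda>n. x n + y n) = (\<lambda>n. inv_into ell2 f x n + inv_into ell2 f y n)"
    if "x \<in> ell2" "y \<in> ell2" for x y
    by (rule Bij_inv_eqI[OF B]) (use that f i ell2_add in \<open>auto simp: unitary_ops_def\<close>)
  moreover have "inv_into ell2 f (\<lambda>n. c * x n) = (\<lambda>n. c * inv_into ell2 f x n)"
    if "x \<in> ell2" for x c
    by (rule Bij_inv_eqI[OF B]) (use that f i ell2_scale in \<open>auto simp: unitary_ops_def\<close>)
  moreover have "ell2_inner (inv_into ell2 f x) (inv_into ell2 f y) = ell2_inner x y"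
    if "x \<in> ell2" "y \<in> ell2" for x y
  proof -
    have "ell2_inner (f (inv_into ell2 f x)) (f (inv_into ell2 f y)) =
          ell2_inner (inv_into ell2 f x) (inv_into ell2 f y)"
      using f i(1) that unfolding unitary_ops_def by blast
    then show ?thesis using i(2) that by simp
  qed
  ultimately show "restrict (inv_into ell2 f) ell2 \<in> unitary_ops"
    using restrict_inv_into_Bij[OF B] by (auto simp: unitary_ops_def ell2_add ell2_scale)
qed


subsection \<open>The infinite symmetric group\<close>

definition sym_omega :: "(nat \<Rightarrow> nat) monoid" where
  "sym_omega = BijGroup UNIV"

definition sym_omega_topology :: "(nat \<Rightarrow> nat) topology" where
  "sym_omega_topology = pointwise_topology (discrete_topology UNIV) (Bij UNIV)"


subsection \<open>Isometry groups and the Urysohn sphere\<close>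

definition isometries :: "'a metric \<Rightarrow> ('a \<Rightarrow> 'a) set" where
  "isometries X = {f \<in> Bij (mspace X).
     \<forall>x \<in> mspace X. \<forall>y \<in> mspace X. mdist X (f x) (f y) = mdist X x y}"

definition isometry_group :: "'a metric \<Rightarrow> ('a \<Rightarrow> 'a) monoid" where
  "isometry_group X = perm_group (mspace X) (isometries X)"

definition isometry_topology :: "'a metric \<Rightarrow> ('a \<Rightarrow> 'a) topology" where
  "isometry_topology X = pointwise_topology (mtopology_of X) (isometries X)"

lemma group_isometry_group: "group (isometry_group X)"
  unfolding isometry_group_def
proof (rule group_perm_group)
  show "isometries X \<subseteq> Bij (mspace X)" by (auto simp: isometries_def)
  show "(\<lambda>x\<in>mspace X. x) \<in> isometries X" by (auto simp: isometries_def id_Bij)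
next
  fix f g assume "f \<in> isometries X" "g \<in> isometries X"
  then show "compose (mspace X) f g \<in> isometries X"
    by (auto simp: isometries_def compose_Bij) (simp add: compose_def Bij_mem)
next
  fix f assume f: "f \<in> isometries X"
  then have B: "f \<in> Bij (mspace X)" by (simp add: isometries_def)
  note i = Bij_inv[OF B]
  have "mdist X (inv_into (mspace X) f x) (inv_into (mspace X) f y) = mdist X x y"
    if "x \<in> mspace X" "y \<in> mspace X" for x y
  proof -
    have "mdist X (f (inv_into (mspace X) f x)) (f (inv_into (mspace X) f y)) =
          mdist X (inv_into (mspace X) f x) (inv_into (mspace X) f y)"
      using f i(1) that unfolding isometries_def by blast
    then show ?thesis using i(2) that by simp
  qed
  then show "restrict (inv_into (mspace X) f) (mspace X) \<in> isometries X"
    using restrict_inv_into_Bij[OF B] by (auto simp: isometries_def)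
qed

definition metric_diameter :: "'a metric \<Rightarrow> ereal" where
  "metric_diameter X = (SUP (x, y) \<in> mspace X \<times> mspace X. ereal (mdist X x y))"

definition isometric_embedding :: "'a metric \<Rightarrow> 'b metric \<Rightarrow> ('a \<Rightarrow> 'b) \<Rightarrow> bool" where
  "isometric_embedding X Y f \<longleftrightarrow>
     f \<in> mspace X \<rightarrow> mspace Y \<and>
     (\<forall>x \<in> mspace X. \<forall>y \<in> mspace X. mdist Y (f x) (f y) = mdist X x y)"

text \<open>
  In the universality clause the test spaces have carrier sets contained in the type of reals.
  A separable metric space has at most continuum many points, so this covers all
  separable metric spaces up to isometry.
\<close>

definition urysohn_sphere :: "'a metric \<Rightarrow> bool" where
  "urysohn_sphere U \<longleftrightarrow>
     mcomplete_of U \<and> separable_space (mtopology_of U) \<and> metric_diameter U = 1 \<and>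
     (\<forall>Y :: real metric.
        separable_space (mtopology_of Y) \<and> metric_diameter Y \<le> 1 \<longrightarrow>
        (\<exists>f. isometric_embedding Y U f)) \<and>
     (\<forall>A f. finite A \<and> A \<subseteq> mspace U \<and> isometric_embedding (submetric U A) U f \<longrightarrow>
        (\<exists>h \<in> isometries U. \<forall>x \<in> A. h x = f x))"


subsection \<open>Homeomorphisms of the unit interval\<close>

definition homeo_plus :: "(real \<Rightarrow> real) set" where
  "homeo_plus = {f \<in> Bij {0..1}.
     homeomorphic_map (top_of_set {0..1}) (top_of_set {0..1}) f \<and> f 0 = 0 \<and> f 1 = 1}"

definition homeo_plus_group :: "(real \<Rightarrow> real) monoid" where
  "homeo_plus_group = perm_group {0..1} homeo_plus"

definition homeo_plus_topology :: "(real \<Rightarrow> real) topology" where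
  "homeo_plus_topology = compact_open_topology (top_of_set {0..1}) homeo_plus"

lemma group_homeo_plus_group: "group homeo_plus_group"
  unfolding homeo_plus_group_def
proof (rule group_perm_group)
  let ?I = "top_of_set {0..1::real}"
  show "homeo_plus \<subseteq> Bij {0..1}" by (auto simp: homeo_plus_def)
  have "homeomorphic_map ?I ?I (\<lambda>x\<in>{0..1}. x)"
    by (rule homeomorphic_map_eq[OF homeomorphic_map_id[of ?I ?I, THEN iffD2, OF refl]]) auto
  then show "(\<lambda>x\<in>{0..1}. x) \<in> homeo_plus" by (auto simp: homeo_plus_def id_Bij)
  show "compose {0..1} f g \<in> homeo_plus" if f: "f \<in> homeo_plus" and g: "g \<in> homeo_plus" for f g
  proof -
    have "homeomorphic_map ?I ?I (f \<circ> g)"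
      using f g unfolding homeo_plus_def by (blast intro: homeomorphic_map_compose)
    then have "homeomorphic_map ?I ?I (compose {0..1} f g)"
      by (rule homeomorphic_map_eq) (auto simp: compose_def)
    then show ?thesis
      using f g by (auto simp: homeo_plus_def compose_Bij) (auto simp: compose_def)
  qed
  show "restrict (inv_into {0..1} f) {0..1} \<in> homeo_plus" if f: "f \<in> homeo_plus" for f
  proof -
    have B: "f \<in> Bij {0..1}" using f by (simp add: homeo_plus_def)
    obtain g where g: "homeomorphic_maps ?I ?I f g"
      using f by (auto simp: homeo_plus_def homeomorphic_map_maps)
    have gi: "g x = inv_into {0..1} f x" if "x \<in> {0..1}" for x
    proof (rule Bij_inv_eqI[OF B, symmetric])
      show "g x \<in> {0..1}"
        using g that unfolding homeomorphic_maps_def continuous_map_def by auto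
      show "f (g x) = x"
        using g that unfolding homeomorphic_maps_def by auto
    qed
    have "homeomorphic_map ?I ?I g"
      using g homeomorphic_maps_sym homeomorphic_maps_map by blast
    then have "homeomorphic_map ?I ?I (restrict (inv_into {0..1} f) {0..1})"
      by (rule homeomorphic_map_eq) (auto simp: gi)
    moreover have "inv_into {0..1} f 0 = 0" "inv_into {0..1} f 1 = 1"
      using f by (auto intro!: Bij_inv_eqI[OF B] simp: homeo_plus_def)
    ultimately show ?thesis
      using restrict_inv_into_Bij[OF B] by (auto simp: homeo_plus_def)
  qed
qed

end

theory Submission
  imports Defs
begin

text \<open>
  If \<open>G\<close> acts continuously by isometries on a complete metric space \<open>X\<close>, then an orbit map
  \<open>g \<mapsto> g x\<close> is uniformly continuous for the left uniformity, because
  \<open>d (g x) (h x) = d x (g\<^sup>-\<^sup>1 h x)\<close>.  It therefore extends to the left completion, and the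
  extension is equivariant: an element of \<open>G\<close> that fixes a point \<open>z\<close> of the completion fixes the
  point \<open>y\<close> of \<open>X\<close> to which \<open>z\<close> is sent (\<open>stabilizer_left_completion_subset\<close>).  In a proper
  action the stabilizer of \<open>y\<close> is compact, in a free action it is trivial.  Hence both are excluded
  by a single \<open>z\<close> whose stabilizer contains a set \<open>D\<close> that lies in no compact set.  The locale
  \<open>noncompactly_stabilized_limit\<close> records what a filter base must satisfy to converge to such
  a \<open>z\<close>; the remaining work is to find one for each group.

  In \<open>U(\<ell>\<^sup>2)\<close>, \<open>S\<^sub>\<infinity>\<close> and \<open>Iso(U)\<close>, all acting by isometries with the topology of pointwise
  convergence, \<open>g\<^sup>-\<^sup>1 h\<close> is near the identity at a point iff \<open>g\<close> and \<open>h\<close> are near each other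
  there.  So the points of the left completion are the pointwise limits \<open>\<zeta>\<close> of group elements, which
  are distance preserving maps that need not be onto, and \<open>g\<close> fixes \<open>\<zeta>\<close> iff it fixes the range of \<open>\<zeta>\<close>
  pointwise.  A range with enough room outside it gives a large stabilizer
  (\<open>noncompactly_stabilized_limit_pointwise\<close>).  For \<open>S\<^sub>\<infinity>\<close> take \<open>\<zeta> n = 2 n\<close> and
  move odd numbers; for \<open>U(\<ell>\<^sup>2)\<close> take \<open>\<zeta> e\<^sub>n = e\<^sub>2\<^sub>n\<close> and permute the odd coordinates.

  For the Urysohn sphere, by homogeneity any isometric self-embedding is a pointwise limit of
  isometries, but isometries between infinite subsets need not extend to the whole space, so the range
  of \<open>\<zeta>\<close> has to be chosen together with the isometries that fix it.  A back-and-forth construction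
  (\<open>stage_step\<close>) produces an isometric copy \<open>z\<^sub>0, z\<^sub>1, \<dots>\<close> of a dense sequence and isometries
  \<open>f\<^sub>0, f\<^sub>1, \<dots>\<close> that fix all \<open>z\<^sub>n\<close> and move one point to points at mutual distance 1.

  In \<open>Homeo\<^sub>+[0,1]\<close> the topology is that of uniform convergence, and \<open>g\<^sup>-\<^sup>1 h\<close> is near the
  identity iff \<open>g\<^sup>-\<^sup>1\<close> and \<open>h\<^sup>-\<^sup>1\<close> are uniformly close.  Points of the completion are uniform
  limits \<open>\<phi>\<close> of inverses, that is, continuous nondecreasing surjections, and \<open>g\<close> fixes \<open>\<phi>\<close> iff
  \<open>\<phi> \<circ> g = \<phi>\<close>.  If \<open>\<phi>\<close> collapses \<open>[0,1/2]\<close> to a point, this holds for every homeomorphism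
  supported in \<open>[0,1/2]\<close>.
\<close>

section \<open>Stabilizers in the left completion fix points of isometric actions\<close>

text \<open>
  The point \<open>y\<close> is the limit of \<open>g x\<close> along \<open>z\<close>, for an arbitrary \<open>x\<close>.
\<close>

lemma stabilizer_left_completion_subset:
  fixes G (structure) and X :: "'x metric"
  assumes G: "group G" and top: "topspace T = carrier G"
    and X: "mspace X \<noteq> {}" "mcomplete_of X" and act: "continuous_isometric_action G T X \<phi>"
    and z: "z \<in> left_completion G T"
  shows "\<exists>y \<in> mspace X. stabilizer G (left_mult_action G T) z \<subseteq> stabilizer G \<phi> y"
proof -
  interpret group G by (rule G)
  interpret \<phi>: group_action G "mspace X" \<phi>
    using act by (simp add: continuous_isometric_action_def)
  let ?d = "mdist X"
  have iso: "?d (\<phi> g x) (\<phi> g y) = ?d x y" if "g \<in> carrier G" "x \<in> mspace X" "y \<in> mspace X" for g x y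
    using act that by (simp add: continuous_isometric_action_def)
  have closed: "\<phi> g x \<in> mspace X" if "g \<in> carrier G" "x \<in> mspace X" for g x
    using \<phi>.element_image that by blast
  have mult: "\<phi> (g \<otimes> h) x = \<phi> g (\<phi> h x)" if "g \<in> carrier G" "h \<in> carrier G" "x \<in> mspace X" for g h x
    using \<phi>.composition_rule[OF that(3,1,2)] .
  have one: "\<phi> \<one> x = x" if "x \<in> mspace X" for x
    using that by (simp add: \<phi>.id_eq_one[symmetric])
  have cau: "left_cauchy G T z" using z by (simp add: left_completion_def)
  have carr: "\<forall>\<^sub>F h in z. h \<in> carrier G" and ne: "z \<noteq> bot"
    using cau by (auto simp: left_cauchy_def le_principal)
  obtain x where x: "x \<in> mspace X" using X by blast
  \<comment> \<open>Translating by \<open>inv a\<close> reduces closeness of \<open>\<phi> a x\<close> and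
      \<open>\<phi> b x\<close> to continuity of the orbit map at \<open>\<one>\<close>.\<close>
  have orbit_cauchy: "\<exists>P. eventually P z \<and> (\<forall>a b. P a \<longrightarrow> P b \<longrightarrow>
      a \<in> carrier G \<and> b \<in> carrier G \<and> ?d (\<phi> a x) (\<phi> b x) < e)" if e: "e > 0" for e
  proof -
    define V where "V = {g \<in> topspace T. \<phi> g x \<in> Metric_space.mball (mspace X) ?d x e}"
    have "continuous_map T (prod_topology T (mtopology_of X)) (\<lambda>g. (g, x))"
      using x by (intro continuous_map_pairedI) auto
    then have "continuous_map T (mtopology_of X) ((\<lambda>(g, x). \<phi> g x) \<circ> (\<lambda>g. (g, x)))"
      using act by (auto simp: continuous_isometric_action_def intro: continuous_map_compose)
    then have "continuous_map T (mtopology_of X) (\<lambda>g. \<phi> g x)" by (simp add: comp_def)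
    then have "openin T V"
      unfolding V_def by (rule openin_continuous_map_preimage)
        (simp add: mtopology_of_def Metric_space.openin_mball Metric_space_mspace_mdist)
    moreover have "\<one> \<in> V"
      using e x by (auto simp: V_def top one Metric_space.mdist_zero[OF Metric_space_mspace_mdist] Metric_space.in_mball[OF Metric_space_mspace_mdist])
    ultimately have "z \<times>\<^sub>F z \<le> principal {(g, h) \<in> carrier G \<times> carrier G. inv g \<otimes> h \<in> V}"
      using cau unfolding left_cauchy_def left_uniformity_def le_INF_iff by auto
    then have "\<forall>\<^sub>F p in z \<times>\<^sub>F z. p \<in> {(g, h) \<in> carrier G \<times> carrier G. inv g \<otimes> h \<in> V}"
      by (simp add: le_principal)
    then obtain P where P: "eventually P z"
      "\<And>a b. P a \<Longrightarrow> P b \<Longrightarrow> a \<in> carrier G \<and> b \<in> carrier G \<and> inv a \<otimes> b \<in> V"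
      unfolding eventually_prod_same by auto
    have "?d (\<phi> a x) (\<phi> b x) < e" if "P a" "P b" for a b
    proof -
      have ab: "a \<in> carrier G" "b \<in> carrier G" "inv a \<otimes> b \<in> V" using P(2) that by auto
      have "?d x (\<phi> (inv a \<otimes> b) x) < e"
        using ab(3) by (simp add: V_def Metric_space.in_mball[OF Metric_space_mspace_mdist])
      moreover have "a \<otimes> (inv a \<otimes> b) = b" using ab by (simp add: m_assoc[symmetric])
      then have "\<phi> b x = \<phi> a (\<phi> (inv a \<otimes> b) x)" using ab x by (metis mult inv_closed m_closed)
      ultimately show ?thesis using iso[of a x "\<phi> (inv a \<otimes> b) x"] ab x closed by simp
    qed
    then show ?thesis using P by blast
  qed
  \<comment> \<open>A sequence that eventually enters one small member of \<open>z\<close> after another is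
      Cauchy, and its limit is the limit along \<open>z\<close>.\<close>
  define e where "e n = inverse (real (Suc n))" for n
  have "\<exists>P. \<forall>n. eventually (P n) z \<and> (\<forall>a b. P n a \<longrightarrow> P n b \<longrightarrow>
      a \<in> carrier G \<and> b \<in> carrier G \<and> ?d (\<phi> a x) (\<phi> b x) < e n)"
    by (intro choice allI orbit_cauchy) (simp add: e_def)
  then obtain P where P: "\<And>n. eventually (P n) z"
    "\<And>n a b. P n a \<Longrightarrow> P n b \<Longrightarrow>
      a \<in> carrier G \<and> b \<in> carrier G \<and> ?d (\<phi> a x) (\<phi> b x) < e n" by blast
  have "\<exists>a. \<forall>n. \<forall>i\<le>n. P i (a n)"
  proof (intro choice allI)
    fix n
    have "\<forall>\<^sub>F h in z. \<forall>i\<in>{..n}. P i h" using P(1) by (intro eventually_ball_finite) auto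
    then show "\<exists>h. \<forall>i\<le>n. P i h" using ne eventually_happens' by fastforce
  qed
  then obtain a where a: "\<And>n i. i \<le> n \<Longrightarrow> P i (a n)" by blast
  have ac: "a n \<in> carrier G" for n using P(2) a by blast
  have "Metric_space.MCauchy (mspace X) ?d (\<lambda>n. \<phi> (a n) x)"
    unfolding Metric_space.MCauchy_def[OF Metric_space_mspace_mdist]
  proof (intro conjI allI impI)
    show "range (\<lambda>n. \<phi> (a n) x) \<subseteq> mspace X" using ac closed x by auto
    fix \<epsilon> :: real assume "\<epsilon> > 0"
    then obtain n where n: "e n < \<epsilon>" unfolding e_def using reals_Archimedean by blast
    show "\<exists>N. \<forall>m m'. N \<le> m \<longrightarrow> N \<le> m' \<longrightarrow> ?d (\<phi> (a m) x) (\<phi> (a m') x) < \<epsilon>"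
      by (rule exI[of _ n]) (use n P(2) a in \<open>fastforce\<close>)
  qed
  then obtain y where "limitin (mtopology_of X) (\<lambda>n. \<phi> (a n) x) y sequentially"
    using X(2) by (auto simp: mcomplete_of_def Metric_space.mcomplete_def[OF Metric_space_mspace_mdist] mtopology_of_def)
  then have y: "y \<in> mspace X"
    and lim: "\<And>\<epsilon>. \<epsilon> > 0 \<Longrightarrow> \<forall>\<^sub>F n in sequentially. ?d (\<phi> (a n) x) y < \<epsilon>"
    unfolding mtopology_of_def Metric_space.limit_metric_sequentially[OF Metric_space_mspace_mdist]
      eventually_sequentially by blast+
  have conv: "\<forall>\<^sub>F h in z. ?d (\<phi> h x) y < \<epsilon>" if \<epsilon>: "\<epsilon> > 0" for \<epsilon>
  proof -
    obtain n where n: "e n < \<epsilon>/2" unfolding e_def using reals_Archimedean[of "\<epsilon>/2"] \<epsilon> by auto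
    have "\<forall>\<^sub>F m in sequentially. ?d (\<phi> (a m) x) y < \<epsilon>/2 \<and> n \<le> m"
      using lim[of "\<epsilon>/2"] \<epsilon> by (intro eventually_conj eventually_ge_at_top) auto
    then obtain m where m: "?d (\<phi> (a m) x) y < \<epsilon>/2" "n \<le> m"
      using eventually_happens' sequentially_bot by blast
    show ?thesis using P(1)[of n]
    proof eventually_elim
      case (elim h)
      then have h: "h \<in> carrier G" "?d (\<phi> h x) (\<phi> (a m) x) < \<epsilon>/2"
        using P(2)[OF elim a[OF m(2)]] n by auto
      have "?d (\<phi> h x) y \<le> ?d (\<phi> h x) (\<phi> (a m) x) + ?d (\<phi> (a m) x) y"
        using h closed ac x y by (intro Metric_space.triangle[OF Metric_space_mspace_mdist]) auto
      then show ?case using h m by simp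
    qed
  qed
  \<comment> \<open>\<open>z\<close> is invariant under \<open>g\<close>, so both \<open>\<phi> h x\<close>
      and \<open>\<phi> g (\<phi> h x)\<close> tend to \<open>y\<close> as \<open>h\<close> runs along
      \<open>z\<close>.\<close>
  have "\<phi> g y = y" if g: "g \<in> carrier G" and gz: "left_mult_action G T g z = z" for g
  proof -
    have "?d (\<phi> g y) y \<le> \<epsilon>" if \<epsilon>: "\<epsilon> > 0" for \<epsilon>
    proof -
      have "filtermap (\<lambda>h. g \<otimes> h) z = z" using gz z by (simp add: left_mult_action_def)
      then have "\<forall>\<^sub>F h in filtermap (\<lambda>h. g \<otimes> h) z. ?d (\<phi> h x) y < \<epsilon>/2"
        using conv[of "\<epsilon>/2"] \<epsilon> by simp
      then have "\<forall>\<^sub>F h in z. ?d (\<phi> (g \<otimes> h) x) y < \<epsilon>/2"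
        by (simp add: eventually_filtermap)
      moreover have "\<forall>\<^sub>F h in z. ?d (\<phi> h x) y < \<epsilon>/2" using conv[of "\<epsilon>/2"] \<epsilon> by simp
      ultimately have "\<forall>\<^sub>F h in z. ?d (\<phi> (g \<otimes> h) x) y < \<epsilon>/2 \<and> ?d (\<phi> h x) y < \<epsilon>/2 \<and> h \<in> carrier G"
        using carr by eventually_elim auto
      then obtain h where h: "?d (\<phi> (g \<otimes> h) x) y < \<epsilon>/2" "?d (\<phi> h x) y < \<epsilon>/2" "h \<in> carrier G"
        using ne eventually_happens' by blast
      have "?d (\<phi> g y) y \<le> ?d (\<phi> g y) (\<phi> g (\<phi> h x)) + ?d (\<phi> g (\<phi> h x)) y"
        using g h(3) closed x y by (intro Metric_space.triangle[OF Metric_space_mspace_mdist]) auto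
      also have "?d (\<phi> g y) (\<phi> g (\<phi> h x)) = ?d (\<phi> h x) y"
        using iso[OF g y closed[OF h(3) x]] by (simp add: mdist_commute)
      also have "\<phi> g (\<phi> h x) = \<phi> (g \<otimes> h) x" using mult g h x by simp
      finally show ?thesis using h by simp
    qed
    then have "?d (\<phi> g y) y \<le> 0" by (rule field_le_epsilon[of _ 0, simplified])
    then show ?thesis
      using Metric_space.zero[OF Metric_space_mspace_mdist, of "\<phi> g y" X y]
        closed[OF g y] y mdist_nonneg[of X "\<phi> g y" y] by simp
  qed
  then have "stabilizer G (left_mult_action G T) z \<subseteq> stabilizer G \<phi> y"
    by (auto simp: stabilizer_def)
  then show ?thesis using y by blast
qed

section \<open>Limits of filter bases with a non-compact stabilizer\<close>

text \<open>
  The sets \<open>N i\<close> are the traces on \<open>G\<close> of neighbourhoods of a point of the completion.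
  \<open>N_small\<close> says that they generate a Cauchy filter, and \<open>N_saturated\<close> that they absorb
  a uniform neighbourhood of a smaller one; the latter makes this Cauchy filter minimal, hence a point
  of the completion.  \<open>D_N\<close> says that left multiplication by an
  element of \<open>D\<close> preserves the filter.
\<close>

locale noncompactly_stabilized_limit = group G for G (structure) +
  fixes T :: "'a topology" and I :: "'i set" and N :: "'i \<Rightarrow> 'a set" and D :: "'a set"
  assumes topspace: "topspace T = carrier G"
    and N_carrier: "i \<in> I \<Longrightarrow> N i \<subseteq> carrier G"
    and N_nonempty: "i \<in> I \<Longrightarrow> N i \<noteq> {}"
    and I_nonempty: "I \<noteq> {}"
    and N_directed: "i \<in> I \<Longrightarrow> j \<in> I \<Longrightarrow> \<exists>k \<in> I. N k \<subseteq> N i \<inter> N j"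
    and N_small: "openin T V \<Longrightarrow> \<one> \<in> V \<Longrightarrow> \<exists>i \<in> I. \<forall>a \<in> N i. \<forall>b \<in> N i. inv a \<otimes> b \<in> V"
    and N_saturated: "i \<in> I \<Longrightarrow> \<exists>j \<in> I. \<exists>V. openin T V \<and> \<one> \<in> V \<and>
      (\<forall>a \<in> N j. \<forall>b \<in> carrier G. inv a \<otimes> b \<in> V \<longrightarrow> b \<in> N i)"
    and D_carrier: "D \<subseteq> carrier G"
    and D_N: "g \<in> D \<Longrightarrow> i \<in> I \<Longrightarrow> \<exists>j \<in> I. \<forall>h \<in> N j. g \<otimes> h \<in> N i"
    and D_not_compact: "compactin T K \<Longrightarrow> \<not> D \<subseteq> K"
begin

definition limit :: "'a filter" where
  "limit = (INF i \<in> I. principal (N i))"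

lemma eventually_limit: "eventually P limit \<longleftrightarrow> (\<exists>i \<in> I. \<forall>h \<in> N i. P h)"
  unfolding limit_def
  by (subst eventually_INF_base) (use N_directed I_nonempty in \<open>auto simp: eventually_principal\<close>)

text \<open>
  A Cauchy filter \<open>F\<close> coarser than the limit has a small member \<open>P\<close>.  As \<open>P\<close> meets
  every \<open>N j\<close>, it lies within the uniform neighbourhood of \<open>N j\<close> that \<open>N_saturated\<close> puts
  inside \<open>N i\<close>; hence \<open>F\<close> is also finer than the limit.
\<close>

lemma limit_in_left_completion: "limit \<in> left_completion G T"
proof -
  have "limit \<noteq> bot"
    using N_nonempty eventually_limit[of "\<lambda>_. False"] by (auto simp: trivial_limit_def)
  moreover have "limit \<le> principal (carrier G)"
    using N_carrier I_nonempty by (fastforce simp: le_principal eventually_limit)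
  moreover have "limit \<times>\<^sub>F limit \<le> left_uniformity G T"
    unfolding left_uniformity_def
  proof (intro INF_greatest)
    fix V assume "V \<in> {V. openin T V \<and> \<one> \<in> V}"
    then obtain i where i: "i \<in> I" "\<forall>a \<in> N i. \<forall>b \<in> N i. inv a \<otimes> b \<in> V" using N_small by blast
    have "\<forall>\<^sub>F h in limit. h \<in> N i" using i by (auto simp: eventually_limit)
    then show "limit \<times>\<^sub>F limit \<le> principal {(g, h) \<in> carrier G \<times> carrier G. inv g \<otimes> h \<in> V}"
      unfolding le_principal eventually_prod_same using N_carrier[OF i(1)] i(2)
      by (intro exI[of _ "\<lambda>h. h \<in> N i"]) auto
  qed
  ultimately have cauchy: "left_cauchy G T limit" by (simp add: left_cauchy_def)
  have "F \<le> limit" if F: "left_cauchy G T F" and le: "limit \<le> F" for F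
    unfolding limit_def
  proof (intro INF_greatest)
    fix i assume "i \<in> I"
    then obtain j V where j: "j \<in> I" and V: "openin T V" "\<one> \<in> V"
      and jV: "\<forall>a \<in> N j. \<forall>b \<in> carrier G. inv a \<otimes> b \<in> V \<longrightarrow> b \<in> N i"
      using N_saturated by blast
    have "F \<times>\<^sub>F F \<le> principal {(g, h) \<in> carrier G \<times> carrier G. inv g \<otimes> h \<in> V}"
      using F V unfolding left_cauchy_def left_uniformity_def le_INF_iff by auto
    then obtain P where P: "eventually P F"
      "\<And>a b. P a \<Longrightarrow> P b \<Longrightarrow> a \<in> carrier G \<and> b \<in> carrier G \<and> inv a \<otimes> b \<in> V"
      unfolding le_principal eventually_prod_same by auto
    have "eventually P limit" using P(1) le by (simp add: le_filter_def)
    then obtain k where k: "k \<in> I" "\<forall>h \<in> N k. P h" by (auto simp: eventually_limit)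
    obtain l where l: "l \<in> I" "N l \<subseteq> N j \<inter> N k" using N_directed[OF j k(1)] by blast
    then obtain a where "a \<in> N j" "P a" using N_nonempty[OF l(1)] k(2) by blast
    then have "\<And>b. P b \<Longrightarrow> b \<in> N i" using P(2) jV by blast
    then show "F \<le> principal (N i)"
      unfolding le_principal by (rule eventually_mono[OF P(1)])
  qed
  then show ?thesis using cauchy by (auto simp: left_completion_def intro: antisym)
qed

text \<open>
  Translation by \<open>g\<close> yields a finer filter, and distinct minimal Cauchy filters are never
  comparable.
\<close>

lemma D_subset_stabilizer: "D \<subseteq> stabilizer G (left_mult_action G T) limit"
proof
  fix g assume g: "g \<in> D"
  then have gG: "g \<in> carrier G" using D_carrier by blast
  have "filtermap (\<lambda>h. g \<otimes> h) limit \<le> limit"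
  proof (rule filter_leI)
    fix P assume "eventually P limit"
    then obtain i where i: "i \<in> I" "\<forall>h \<in> N i. P h" by (auto simp: eventually_limit)
    with D_N[OF g] show "eventually P (filtermap (\<lambda>h. g \<otimes> h) limit)"
      by (fastforce simp: eventually_filtermap eventually_limit)
  qed
  moreover have "filtermap (\<lambda>h. g \<otimes> h) limit \<in> left_completion G T"
    using left_completion_translate[OF limit_in_left_completion gG] .
  ultimately have "limit = filtermap (\<lambda>h. g \<otimes> h) limit"
    using limit_in_left_completion by (simp add: left_completion_def)
  then have "filtermap (\<lambda>h. g \<otimes> h) limit = limit" by (rule sym)
  then show "g \<in> stabilizer G (left_mult_action G T) limit"
    using gG limit_in_left_completion by (simp add: stabilizer_def left_mult_action_def)
qed

lemma noncompact_stabilizer: "has_noncompact_stabilizer G T"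
  using limit_in_left_completion D_subset_stabilizer D_not_compact
  by (auto simp: has_noncompact_stabilizer_def)

lemma no_proper_or_free: "no_proper_or_free_isometric_action G T TYPE('x)"
  unfolding no_proper_or_free_isometric_action_def
proof (intro allI impI)
  fix X :: "'x metric" and \<phi>
  assume X: "mspace X \<noteq> {} \<and> mcomplete_of X \<and> continuous_isometric_action G T X \<phi>"
  then obtain y where y: "y \<in> mspace X"
    "stabilizer G (left_mult_action G T) limit \<subseteq> stabilizer G \<phi> y"
    using stabilizer_left_completion_subset[OF is_group topspace, of X \<phi> limit]
      limit_in_left_completion by blast
  then have D: "D \<subseteq> stabilizer G \<phi> y" using D_subset_stabilizer by blast
  have "\<not> proper_action G T (mtopology_of X) \<phi>"
  proof
    assume "proper_action G T (mtopology_of X) \<phi>"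
    \<comment> \<open>The preimage of the single point \<open>(y, y)\<close> is the stabilizer of
        \<open>y\<close> times \<open>{y}\<close>.\<close>
    moreover have "compactin (prod_topology (mtopology_of X) (mtopology_of X)) {(y, y)}"
      using y by simp
    ultimately have "compactin (prod_topology T (mtopology_of X))
        {(g, x) \<in> carrier G \<times> topspace (mtopology_of X). (\<phi> g x, x) \<in> {(y, y)}}"
      unfolding proper_action_def by blast
    then have "compactin T (fst ` {(g, x) \<in> carrier G \<times> topspace (mtopology_of X). (\<phi> g x, x) \<in> {(y, y)}})"
      using image_compactin continuous_map_fst by blast
    moreover have "D \<subseteq> fst ` {(g, x) \<in> carrier G \<times> topspace (mtopology_of X). (\<phi> g x, x) \<in> {(y, y)}}"
      using D y by (force simp: stabilizer_def image_iff)
    ultimately show False using D_not_compact by blast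
  qed
  moreover have "\<not> free_action G (mspace X) \<phi>"
  proof
    assume "free_action G (mspace X) \<phi>"
    then have "D \<subseteq> {\<one>}" using D y by (auto simp: stabilizer_def free_action_def)
    moreover have "compactin T {\<one>}" by (simp add: topspace)
    ultimately show False using D_not_compact by blast
  qed
  ultimately show "\<not> proper_action G T (mtopology_of X) \<phi> \<and> \<not> free_action G (mspace X) \<phi>" ..
qed

lemma no_proper_or_free_affine: "no_proper_or_free_affine_isometric_action G T TYPE('v::banach)"
  unfolding no_proper_or_free_affine_isometric_action_def
proof (intro allI impI)
  fix \<phi> :: "'a \<Rightarrow> 'v \<Rightarrow> 'v"
  assume \<phi>: "continuous_isometric_action G T euclidean_metric \<phi> \<and> affine_action G \<phi>"
  have "mcomplete_of (euclidean_metric :: 'v metric)"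
    by (simp add: mcomplete_of_def complete_UNIV)
  then have "\<not> proper_action G T (mtopology_of euclidean_metric) \<phi> \<and>
      \<not> free_action G (mspace euclidean_metric) \<phi>"
    using no_proper_or_free[where 'x = 'v, unfolded no_proper_or_free_isometric_action_def, rule_format,
        of euclidean_metric \<phi>] \<phi> by simp
  then show "\<not> proper_action G T euclidean \<phi> \<and> \<not> free_action G UNIV \<phi>" by simp
qed

end

section \<open>Groups of isometries with the topology of pointwise convergence\<close>

context
  fixes S :: "'a set" and H and G
  assumes group: "group G" and G: "G = perm_group S H" and H: "H \<subseteq> Bij S"
begin

lemma perm_group_carrier: "carrier G = H"
  by (simp add: G)

lemma perm_group_mult_apply:
  "f \<in> H \<Longrightarrow> g \<in> H \<Longrightarrow> x \<in> S \<Longrightarrow> (f \<otimes>\<^bsub>G\<^esub> g) x = f (g x)"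
  using H by (auto simp: G BijGroup_def compose_def)

lemma perm_group_one: "\<one>\<^bsub>G\<^esub> = (\<lambda>x\<in>S. x)"
  by (simp add: G BijGroup_def)

lemma perm_group_inv_closed: "f \<in> H \<Longrightarrow> inv\<^bsub>G\<^esub> f \<in> H"
  using group.inv_closed[OF group] by (simp add: perm_group_carrier)

lemma perm_group_inv_apply:
  assumes "f \<in> H" "x \<in> S"
  shows "(inv\<^bsub>G\<^esub> f) (f x) = x" "f ((inv\<^bsub>G\<^esub> f) x) = x"
proof -
  note inv = perm_group_inv_closed[OF assms(1)]
  show "(inv\<^bsub>G\<^esub> f) (f x) = x"
    using perm_group_mult_apply[OF inv assms] group.l_inv[OF group, of f] assms
    by (simp add: perm_group_one perm_group_carrier)
  show "f ((inv\<^bsub>G\<^esub> f) x) = x"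
    using perm_group_mult_apply[OF assms(1) inv assms(2)] group.r_inv[OF group, of f] assms
    by (simp add: perm_group_one perm_group_carrier)
qed

end

lemma topspace_pointwise_topology:
  assumes "H \<subseteq> Bij (topspace Y)"
  shows "topspace (pointwise_topology Y H) = H"
  using assms by (auto simp: pointwise_topology_def Bij_def bij_betw_def PiE_def)

text \<open>
  Together with the next lemma this describes the neighbourhoods of the identity: control of finitely
  many values.
\<close>

lemma openin_pointwise_topology_finite:
  assumes H: "H \<subseteq> Bij (topspace Y)" and A: "finite A" "A \<subseteq> topspace Y"
    and U: "\<And>x. x \<in> A \<Longrightarrow> openin Y (U x)"
  shows "openin (pointwise_topology Y H) {h \<in> H. \<forall>x \<in> A. h x \<in> U x}"
  using A U
proof (induction A rule: finite_induct)
  case empty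
  then show ?case using openin_topspace[of "pointwise_topology Y H"]
    by (simp add: topspace_pointwise_topology[OF H])
next
  case (insert a A)
  have "continuous_map (pointwise_topology Y H) Y (\<lambda>h. h a)"
    unfolding pointwise_topology_def
    using insert.prems by (intro continuous_map_from_subtopology continuous_map_product_projection) auto
  then have "openin (pointwise_topology Y H) {h \<in> H. h a \<in> U a}"
    using openin_continuous_map_preimage[of "pointwise_topology Y H" Y "\<lambda>h. h a" "U a"] insert.prems
    by (simp add: topspace_pointwise_topology[OF H])
  moreover have "openin (pointwise_topology Y H) {h \<in> H. \<forall>x \<in> A. h x \<in> U x}"
    using insert by simp
  ultimately show ?case
    using openin_Int[of "pointwise_topology Y H" "{h \<in> H. h a \<in> U a}" "{h \<in> H. \<forall>x \<in> A. h x \<in> U x}"]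
    by (simp add: Collect_conj_eq[symmetric] conj_ac Int_def cong: conj_cong)
qed

lemma pointwise_nbhd_of_one:
  fixes M :: "'a metric"
  assumes H: "H \<subseteq> Bij (mspace M)" and V: "openin (pointwise_topology (mtopology_of M) H) V"
    and one: "(\<lambda>x\<in>mspace M. x) \<in> V"
  obtains A e where "finite A" "A \<subseteq> mspace M" "e > 0"
    "\<And>h. h \<in> H \<Longrightarrow> (\<And>x. x \<in> A \<Longrightarrow> mdist M (h x) x < e) \<Longrightarrow> h \<in> V"
proof -
  let ?S = "mspace M"
  interpret Metric_space ?S "mdist M" by simp
  obtain W where W: "openin (product_topology (\<lambda>_. mtopology_of M) ?S) W" "V = W \<inter> H"
    using V by (auto simp: pointwise_topology_def openin_subtopology)
  then have "(\<lambda>x\<in>?S. x) \<in> W" using one by simp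
  then have "\<exists>U. finite {i \<in> ?S. U i \<noteq> topspace (mtopology_of M)} \<and>
      (\<forall>i \<in> ?S. openin (mtopology_of M) (U i)) \<and> (\<lambda>x\<in>?S. x) \<in> Pi\<^sub>E ?S U \<and> Pi\<^sub>E ?S U \<subseteq> W"
    by (rule bspec[OF W(1)[unfolded openin_product_topology_alt]])
  then obtain U where U: "finite {i \<in> ?S. U i \<noteq> ?S}" "\<forall>i \<in> ?S. openin (mtopology_of M) (U i)"
    "(\<lambda>x\<in>?S. x) \<in> Pi\<^sub>E ?S U" "Pi\<^sub>E ?S U \<subseteq> W"
    unfolding topspace_mtopology_of by (elim exE conjE)
  define A where "A = {i \<in> ?S. U i \<noteq> ?S}"
  have "\<exists>r>0. mball x r \<subseteq> U x" if "x \<in> A" for x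
  proof -
    have "x \<in> U x" using U(3) that by (auto simp: A_def PiE_iff)
    then show ?thesis using bspec[OF U(2), of x] that by (auto simp: A_def mtopology_of_def openin_mtopology)
  qed
  then obtain r where r: "\<And>x. x \<in> A \<Longrightarrow> r x > 0 \<and> mball x (r x) \<subseteq> U x" by metis
  define e where "e = Min (insert 1 (r ` A))"
  have fin: "finite A" using U(1) by (simp add: A_def)
  have e: "e > 0" "\<And>x. x \<in> A \<Longrightarrow> e \<le> r x"
    using fin r by (simp_all add: e_def)
  show ?thesis
  proof (rule that[of A e])
    fix h assume h: "h \<in> H" and hA: "\<And>x. x \<in> A \<Longrightarrow> mdist M (h x) x < e"
    have hS: "h x \<in> ?S" if "x \<in> ?S" for x
      using Bij_mem[of h ?S x] h H that by blast
    have "h x \<in> U x" if "x \<in> ?S" for x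
    proof (cases "x \<in> A")
      case True
      then have "h x \<in> mball x (r x)"
        using hA[OF True] e(2)[OF True] hS that by (simp add: commute)
      then show ?thesis using r True by blast
    next
      case False
      then show ?thesis using hS that by (auto simp: A_def)
    qed
    moreover have "h \<in> extensional ?S" using h H by (auto simp: Bij_def)
    ultimately have "h \<in> Pi\<^sub>E ?S U" by (simp add: PiE_iff)
    then show "h \<in> V" using U(4) W(2) h by blast
  qed (use fin e in \<open>auto simp: A_def\<close>)
qed

text \<open>
  Evaluation at \<open>x\<close> is continuous and would map a compact set containing the sequence to a totally
  bounded set containing infinitely many \<open>\<delta>\<close>-separated points.
\<close>

lemma not_compact_if_separated_orbit:
  fixes M :: "'a metric" and g :: "nat \<Rightarrow> 'a \<Rightarrow> 'a"
  assumes H: "H \<subseteq> Bij (mspace M)" and K: "compactin (pointwise_topology (mtopology_of M) H) K"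
    and x: "x \<in> mspace M" and \<delta>: "\<delta> > 0" "\<And>j k. j \<noteq> k \<Longrightarrow> \<delta> \<le> mdist M (g j x) (g k x)"
  shows "\<not> range g \<subseteq> K"
proof
  assume g: "range g \<subseteq> K"
  interpret Metric_space "mspace M" "mdist M" by simp
  have "continuous_map (pointwise_topology (mtopology_of M) H) (mtopology_of M) (\<lambda>h. h x)"
    unfolding pointwise_topology_def
    using x by (intro continuous_map_from_subtopology continuous_map_product_projection) auto
  then have "compactin (mtopology_of M) ((\<lambda>h. h x) ` K)"
    by (rule image_compactin[OF K])
  then have "mtotally_bounded ((\<lambda>h. h x) ` K)"
    by (simp add: mtopology_of_def compactin_imp_mtotally_bounded)
  then obtain B where B: "finite B" "(\<lambda>h. h x) ` K \<subseteq> (\<Union>y\<in>B. mball y (\<delta>/2))"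
    unfolding mtotally_bounded_def using \<delta>(1) by (meson half_gt_zero)
  have "\<exists>y \<in> B. g k x \<in> mball y (\<delta>/2)" for k using B(2) g by blast
  then obtain c where c: "\<And>k. c k \<in> B \<and> g k x \<in> mball (c k) (\<delta>/2)" by metis
  have "finite (range c)" using c B(1) by (meson finite_subset image_subsetI)
  then have "\<not> inj c" using finite_imageD infinite_UNIV_nat by blast
  then obtain j k where jk: "j \<noteq> k" "c j = c k" by (auto simp: inj_def)
  have "mdist M (g j x) (g k x) \<le> mdist M (g j x) (c j) + mdist M (c j) (g k x)"
    using c[of j] c[of k] by (intro triangle) (auto simp: mball_def)
  also have "\<dots> < \<delta>" using c[of j] c[of k] jk(2) by (auto simp: commute)
  finally show False using \<delta>(2)[OF jk(1)] by simp
qed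

text \<open>
  The filter base consists of the elements of \<open>H\<close> that approximate \<open>\<zeta>\<close> on a finite set.  Since
  \<open>d (inv a (b x)) x = d (b x) (a x)\<close> for isometries (\<open>shift\<close> below), the left
  uniformity is the uniformity of pointwise convergence.  As \<open>g k\<close> fixes \<open>\<zeta> x\<close>, it maps
  each member of the base into itself.
\<close>

lemma noncompactly_stabilized_limit_pointwise:
  fixes M :: "'a metric" and g :: "nat \<Rightarrow> 'a \<Rightarrow> 'a"
  assumes G: "group (perm_group (mspace M) H)" and H: "H \<subseteq> isometries M"
    and \<zeta>: "\<zeta> \<in> mspace M \<rightarrow> mspace M"
    and approx: "\<And>A e. finite A \<Longrightarrow> A \<subseteq> mspace M \<Longrightarrow> e > 0 \<Longrightarrow>
      \<exists>h \<in> H. \<forall>x \<in> A. mdist M (h x) (\<zeta> x) < e"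
    and g: "\<And>k. g k \<in> H" "\<And>k x. x \<in> mspace M \<Longrightarrow> g k (\<zeta> x) = \<zeta> x"
    and sep: "x\<^sub>0 \<in> mspace M" "\<delta> > 0" "\<And>j k. j \<noteq> k \<Longrightarrow> \<delta> \<le> mdist M (g j x\<^sub>0) (g k x\<^sub>0)"
  shows "noncompactly_stabilized_limit (perm_group (mspace M) H)
    (pointwise_topology (mtopology_of M) H)
    {(A, e). finite A \<and> A \<subseteq> mspace M \<and> e > 0}
    (\<lambda>(A, e). {h \<in> H. \<forall>x \<in> A. mdist M (h x) (\<zeta> x) < e}) (range g)"
proof -
  let ?S = "mspace M" and ?d = "mdist M"
  let ?T = "pointwise_topology (mtopology_of M) H"
  define G where "G = perm_group ?S H"
  have grp: "group G" using G by (simp add: G_def)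
  let ?N = "\<lambda>(A, e). {h \<in> H. \<forall>x \<in> A. ?d (h x) (\<zeta> x) < (e::real)}"
  let ?I = "{(A, e). finite A \<and> A \<subseteq> ?S \<and> (e::real) > 0}"
  interpret Metric_space ?S ?d by simp
  have Bij: "H \<subseteq> Bij ?S" using H by (auto simp: isometries_def)
  have HS: "h x \<in> ?S" if "h \<in> H" "x \<in> ?S" for h x
    using Bij_mem[of h ?S x] that Bij by blast
  have iso: "?d (h x) (h y) = ?d x y" if "h \<in> H" "x \<in> ?S" "y \<in> ?S" for h x y
    using that H by (auto simp: isometries_def)
  note inv_closed = perm_group_inv_closed[OF grp G_def Bij]
  have shift: "?d ((inv\<^bsub>G\<^esub> a \<otimes>\<^bsub>G\<^esub> b) x) x = ?d (b x) (a x)"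
    if "a \<in> H" "b \<in> H" "x \<in> ?S" for a b x
    using iso[OF that(1), of "(inv\<^bsub>G\<^esub> a) (b x)" x] that HS inv_closed
    by (simp add: perm_group_mult_apply[OF grp G_def Bij] perm_group_inv_apply[OF grp G_def Bij])
  have carrier: "carrier G = H" by (simp add: G_def)
  note one = perm_group_one[OF grp G_def Bij]
  have mem: "a \<otimes>\<^bsub>G\<^esub> b \<in> H" if "a \<in> H" "b \<in> H" for a b
    using monoid.m_closed[OF group.is_monoid[OF grp], of a b] that by (simp add: carrier)
  show ?thesis
    unfolding G_def[symmetric]
  proof (intro noncompactly_stabilized_limit.intro noncompactly_stabilized_limit_axioms.intro)
    show "group G" by (rule grp)
    show "topspace ?T = carrier G" using topspace_pointwise_topology[of H "mtopology_of M"] Bij by (simp add: carrier)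
    show "?N i \<subseteq> carrier G" if "i \<in> ?I" for i by (cases i) (auto simp: carrier)
    show "?N i \<noteq> {}" if "i \<in> ?I" for i using that approx by (cases i) fastforce
    show "?I \<noteq> {}" by (auto intro!: exI[of _ "{}"] exI[of _ 1])
    show "\<exists>k \<in> ?I. ?N k \<subseteq> ?N i \<inter> ?N j" if i: "i \<in> ?I" and j: "j \<in> ?I" for i j
    proof -
      obtain A e B d where "i = (A, e)" "j = (B, d)" by fastforce
      then show ?thesis using i j by (intro bexI[of _ "(A \<union> B, min e d)"]) auto
    qed
    show "\<exists>i \<in> ?I. \<forall>a \<in> ?N i. \<forall>b \<in> ?N i. inv\<^bsub>G\<^esub> a \<otimes>\<^bsub>G\<^esub> b \<in> V"
      if V: "openin ?T V" "\<one>\<^bsub>G\<^esub> \<in> V" for V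
    proof -
      have "(\<lambda>x\<in>?S. x) \<in> V" using V(2) by (simp add: one)
      then obtain A e where A: "finite A" "A \<subseteq> ?S" "e > 0"
        "\<And>h. h \<in> H \<Longrightarrow> (\<And>x. x \<in> A \<Longrightarrow> ?d (h x) x < e) \<Longrightarrow> h \<in> V"
        using pointwise_nbhd_of_one[OF Bij V(1)] by metis
      show ?thesis
      proof (rule bexI[of _ "(A, e/2)"])
        show "\<forall>a \<in> ?N (A, e/2). \<forall>b \<in> ?N (A, e/2). inv\<^bsub>G\<^esub> a \<otimes>\<^bsub>G\<^esub> b \<in> V"
        proof (intro ballI)
          fix a b assume a: "a \<in> ?N (A, e/2)" and b: "b \<in> ?N (A, e/2)"
          show "inv\<^bsub>G\<^esub> a \<otimes>\<^bsub>G\<^esub> b \<in> V"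
          proof (rule A(4))
            show "inv\<^bsub>G\<^esub> a \<otimes>\<^bsub>G\<^esub> b \<in> H"
              using mem a b inv_closed by auto
            fix x assume x: "x \<in> A"
            then have xS: "x \<in> ?S" "\<zeta> x \<in> ?S" using A \<zeta> by auto
            have "?d (b x) (a x) \<le> ?d (b x) (\<zeta> x) + ?d (\<zeta> x) (a x)"
              using a b xS HS by (intro triangle) auto
            moreover have "?d (b x) (\<zeta> x) < e/2" "?d (\<zeta> x) (a x) < e/2"
              using a b x by (auto simp: commute)
            ultimately show "?d ((inv\<^bsub>G\<^esub> a \<otimes>\<^bsub>G\<^esub> b) x) x < e"
              using a b xS shift[of a b x] by simp
          qed
        qed
      qed (use A in auto)
    qed
    show "\<exists>j \<in> ?I. \<exists>V. openin ?T V \<and> \<one>\<^bsub>G\<^esub> \<in> V \<and>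
        (\<forall>a \<in> ?N j. \<forall>b \<in> carrier G. inv\<^bsub>G\<^esub> a \<otimes>\<^bsub>G\<^esub> b \<in> V \<longrightarrow> b \<in> ?N i)" if i: "i \<in> ?I" for i
    proof -
      obtain A e where Ae: "i = (A, e)" by fastforce
      then have A: "finite A" "A \<subseteq> ?S" "e > 0" using i by auto
      let ?V = "{h \<in> H. \<forall>x \<in> A. h x \<in> mball x (e/2)}"
      have "openin ?T ?V"
        using Bij A by (intro openin_pointwise_topology_finite) (auto simp: mtopology_of_def)
      moreover have "\<one>\<^bsub>G\<^esub> \<in> ?V"
        using A monoid.one_closed[OF group.is_monoid[OF grp]] by (auto simp: one carrier)
      moreover have "b \<in> ?N i"
        if a: "a \<in> ?N (A, e/2)" and b: "b \<in> carrier G" and ab: "inv\<^bsub>G\<^esub> a \<otimes>\<^bsub>G\<^esub> b \<in> ?V" for a b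
      proof -
        have "?d (b x) (\<zeta> x) < e" if x: "x \<in> A" for x
        proof -
          have xS: "x \<in> ?S" "\<zeta> x \<in> ?S" using A x \<zeta> by auto
          have "?d (b x) (a x) < e/2" using ab x xS shift[of a b x] a b by (auto simp: commute carrier)
          moreover have "?d (b x) (\<zeta> x) \<le> ?d (b x) (a x) + ?d (a x) (\<zeta> x)"
            using a b xS HS by (intro triangle) (auto simp: carrier)
          ultimately show ?thesis using a x by auto
        qed
        then show ?thesis using b Ae by (auto simp: carrier)
      qed
      ultimately show ?thesis
        using A by (intro bexI[of _ "(A, e/2)"] exI[of _ ?V] conjI ballI impI) auto
    qed
    show "range g \<subseteq> carrier G" using g(1) by (auto simp: carrier)
    show "\<exists>j \<in> ?I. \<forall>h \<in> ?N j. f \<otimes>\<^bsub>G\<^esub> h \<in> ?N i" if f: "f \<in> range g" and i: "i \<in> ?I" for f i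
    proof -
      obtain A e where Ae: "i = (A, e)" by fastforce
      have "f \<otimes>\<^bsub>G\<^esub> h \<in> ?N i" if h: "h \<in> ?N i" for h
      proof -
        have fH: "f \<in> H" and hH: "h \<in> H" using f g(1) h Ae by auto
        have "?d ((f \<otimes>\<^bsub>G\<^esub> h) x) (\<zeta> x) < e" if x: "x \<in> A" for x
        proof -
          have xS: "x \<in> ?S" "\<zeta> x \<in> ?S" using i Ae x \<zeta> by auto
          have "f (\<zeta> x) = \<zeta> x" using f g(2) xS by auto
          then have "?d ((f \<otimes>\<^bsub>G\<^esub> h) x) (\<zeta> x) = ?d (f (h x)) (f (\<zeta> x))"
            using perm_group_mult_apply[OF grp G_def Bij fH hH xS(1)] by simp
          also have "\<dots> = ?d (h x) (\<zeta> x)" using iso[OF fH] HS[OF hH] xS by simp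
          finally show ?thesis using h Ae x by auto
        qed
        moreover have "f \<otimes>\<^bsub>G\<^esub> h \<in> H"
          using mem fH hH by simp
        ultimately show ?thesis using Ae by auto
      qed
      then show ?thesis using i by blast
    qed
    show "\<not> range g \<subseteq> K" if "compactin ?T K" for K
      by (rule not_compact_if_separated_orbit[where x = x\<^sub>0 and g = g, OF Bij that sep])
  qed
qed

section \<open>The infinite symmetric group\<close>

text \<open>
  To prescribe one more value, compose with a transposition; injectivity of \<open>f\<close> on the finite set
  ensures that the values already prescribed are not moved.
\<close>

lemma finite_injection_extends_to_bijection:
  fixes f :: "'a \<Rightarrow> 'a"
  assumes "finite A" "inj_on f A"
  shows "\<exists>h. bij h \<and> (\<forall>x \<in> A. h x = f x)"
  using assms
proof (induction A rule: finite_induct)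
  case empty
  then show ?case using bij_id by blast
next
  case (insert a A)
  then obtain h where h: "bij h" "\<And>x. x \<in> A \<Longrightarrow> h x = f x" by auto
  have "(Transposition.transpose (h a) (f a) \<circ> h) x = f x" if "x \<in> insert a A" for x
  proof (cases "x = a")
    case False
    then have "x \<in> A" using that by simp
    then have "h x \<noteq> f a" using insert.prems insert.hyps(2) h(2) by (auto simp: inj_on_def)
    moreover have "h x \<noteq> h a" using h(1) False by (auto simp: bij_def inj_def)
    ultimately show ?thesis using h(2) \<open>x \<in> A\<close> by simp
  qed simp
  moreover have "bij (Transposition.transpose (h a) (f a) \<circ> h)"
    using h(1) by (intro bij_comp) auto
  ultimately show ?case by blast
qed

lemma doubling_shift_by_bijection:
  fixes A :: "nat set"
  assumes "finite A"
  obtains h :: "nat \<Rightarrow> nat" where "bij h" "\<And>n. n \<in> A \<Longrightarrow> h n = 2 * n"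
  using finite_injection_extends_to_bijection[OF assms, of "\<lambda>n. 2 * n"] by (auto simp: inj_on_def)

text \<open>
  With the discrete metric \<open>S\<^sub>\<infinity>\<close> is an isometry group.  Finite parts of \<open>n \<mapsto> 2 n\<close> extend to
  bijections, and the transpositions of \<open>1\<close> with the odd numbers \<open>2 k + 3\<close> fix all even numbers.
\<close>

lemma sym_omega_stabilized_limit:
  "\<exists>(I :: (nat set \<times> real) set) N D. noncompactly_stabilized_limit sym_omega sym_omega_topology I N D"
proof -
  define M :: "nat metric" where "M = metric (UNIV, discrete_metric.dd)"
  have S: "mspace M = UNIV" and d: "mdist M = discrete_metric.dd"
    by (simp_all add: M_def Metric_space.mspace_metric[OF metric_M_dd] Metric_space.mdist_metric[OF metric_M_dd])
  have top: "mtopology_of M = discrete_topology UNIV"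
    by (simp add: mtopology_of_def S d discrete_metric.mtopology_discrete_metric)
  have G: "sym_omega = perm_group (mspace M) (Bij UNIV)"
    by (simp add: sym_omega_def BijGroup_def S)
  have T: "sym_omega_topology = pointwise_topology (mtopology_of M) (Bij UNIV)"
    by (simp add: sym_omega_topology_def top)
  have bij: "f \<in> Bij UNIV" if "bij f" for f :: "nat \<Rightarrow> nat"
    using that by (simp add: Bij_def)
  have "noncompactly_stabilized_limit (perm_group (mspace M) (Bij UNIV))
    (pointwise_topology (mtopology_of M) (Bij UNIV))
    {(A, e). finite A \<and> A \<subseteq> mspace M \<and> (e::real) > 0}
    (\<lambda>(A, e). {h \<in> Bij UNIV. \<forall>x \<in> A. mdist M (h x) (2 * x) < e}) (range (\<lambda>k. Transposition.transpose 1 (2 * k + 3)))"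
  proof (rule noncompactly_stabilized_limit_pointwise)
    show "group (perm_group (mspace M) (Bij UNIV))"
      unfolding G[symmetric] sym_omega_def by (rule group_BijGroup)
    show "Bij UNIV \<subseteq> isometries M"
      by (auto simp: isometries_def S d discrete_metric.dd_def Bij_def bij_def inj_def)
    show "(*) 2 \<in> mspace M \<rightarrow> mspace M" by (simp add: S)
    show "\<exists>h \<in> Bij UNIV. \<forall>x \<in> A. mdist M (h x) (2 * x) < e" if A: "finite A" "e > 0" for A e
    proof -
      obtain h where "bij h" "\<And>n. n \<in> A \<Longrightarrow> h n = 2 * n"
        using doubling_shift_by_bijection[OF A(1)] by blast
      then show ?thesis using bij A(2) by (intro bexI[of _ h]) (auto simp: d discrete_metric.dd_def)
    qed
    show "Transposition.transpose 1 (2 * k + 3) \<in> Bij UNIV" for k :: nat by (rule bij) simp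
    show "Transposition.transpose 1 (2 * k + 3) (2 * x) = 2 * x" for k x :: nat
      by (rule transpose_apply_other) presburger+
    show "1 \<in> mspace M" by (simp add: S)
    show "0 < (1::real)" by simp
    show "1 \<le> mdist M (Transposition.transpose 1 (2 * j + 3) 1) (Transposition.transpose 1 (2 * k + 3) 1)" if "j \<noteq> k" for j k :: nat
      using that by (simp add: d discrete_metric.dd_def)
  qed
  then show ?thesis unfolding G T by blast
qed

section \<open>The unitary group\<close>

lemma mspace_ell2_metric: "mspace ell2_metric = ell2"
  and mdist_ell2_metric: "mdist ell2_metric = (\<lambda>x y. ell2_norm (\<lambda>n. x n - y n))"
  by (simp_all add: ell2_metric_def Metric_space.mspace_metric[OF Metric_space_ell2]
      Metric_space.mdist_metric[OF Metric_space_ell2])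

lemma cmod_le_ell2_norm:
  assumes "x \<in> ell2"
  shows "cmod (x n) \<le> ell2_norm x"
proof -
  have "(\<Sum>n\<in>{n}. (cmod (x n))\<^sup>2) \<le> (\<Sum>\<^sub>\<infinity>n. (cmod (x n))\<^sup>2)"
    by (rule finite_sum_le_infsum) (use assms in \<open>auto simp: ell2_def\<close>)
  then show ?thesis unfolding ell2_norm_def by (intro real_le_rsqrt) simp
qed

lemma ell2_inner_self:
  assumes "x \<in> ell2"
  shows "ell2_inner x x = of_real ((ell2_norm x)\<^sup>2)"
proof -
  have "((\<lambda>n. (cmod (x n))\<^sup>2) has_sum (ell2_norm x)\<^sup>2) UNIV"
    using has_sum_infsum[of "\<lambda>n. (cmod (x n))\<^sup>2" UNIV] assms
    by (simp add: ell2_def ell2_norm_def infsum_nonneg)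
  then have "((\<lambda>n. of_real ((cmod (x n))\<^sup>2)) has_sum (of_real ((ell2_norm x)\<^sup>2) :: complex)) UNIV"
    by (rule has_sum_of_real_iff[THEN iffD2])
  then have "(\<Sum>\<^sub>\<infinity>n. of_real ((cmod (x n))\<^sup>2)) = (of_real ((ell2_norm x)\<^sup>2) :: complex)"
    by (rule infsumI)
  then show ?thesis unfolding ell2_inner_def by (simp only: complex_norm_square)
qed

lemma unitary_ops_norm:
  assumes "U \<in> unitary_ops" "x \<in> ell2"
  shows "ell2_norm (U x) = ell2_norm x"
proof -
  have "U x \<in> ell2" using assms Bij_mem[of U ell2 x] by (simp add: unitary_ops_def)
  moreover have "ell2_inner (U x) (U x) = ell2_inner x x" using assms by (simp add: unitary_ops_def)
  ultimately have "(ell2_norm (U x))\<^sup>2 = (ell2_norm x)\<^sup>2"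
    using assms(2) unfolding ell2_inner_self of_real_eq_iff
    by (metis ell2_inner_self of_real_eq_iff)
  then show ?thesis using ell2_norm_nonneg by (simp add: power2_eq_iff_nonneg)
qed

lemma unitary_ops_isometries: "unitary_ops \<subseteq> isometries ell2_metric"
proof
  fix U assume U: "U \<in> unitary_ops"
  then have B: "U \<in> Bij ell2" by (simp add: unitary_ops_def)
  have "ell2_norm (\<lambda>n. U x n - U y n) = ell2_norm (\<lambda>n. x n - y n)" if xy: "x \<in> ell2" "y \<in> ell2" for x y
  proof -
    have add: "\<forall>x\<in>ell2. \<forall>y\<in>ell2. U (\<lambda>n. x n + y n) = (\<lambda>n. U x n + U y n)"
      and scale: "\<forall>c. \<forall>x\<in>ell2. U (\<lambda>n. c * x n) = (\<lambda>n. c * U x n)"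
      using U by (simp_all add: unitary_ops_def)
    have "U (\<lambda>n. - 1 * y n) = (\<lambda>n. - 1 * U y n)" by (rule scale[rule_format, OF xy(2)])
    moreover have "U (\<lambda>n. x n + - 1 * y n) = (\<lambda>n. U x n + U (\<lambda>n. - 1 * y n) n)"
      by (rule add[rule_format, OF xy(1) ell2_scale[OF xy(2)]])
    ultimately have "U (\<lambda>n. x n - y n) = (\<lambda>n. U x n - U y n)" by simp
    then show ?thesis using unitary_ops_norm[OF U ell2_diff[OF xy]] by simp
  qed
  then show "U \<in> isometries ell2_metric"
    using B by (simp add: isometries_def mspace_ell2_metric mdist_ell2_metric)
qed

lemma ell2_permute:
  assumes "bij \<pi>"
  shows "(\<lambda>m. x (\<pi> m)) \<in> ell2 \<longleftrightarrow> x \<in> ell2"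
  using summable_on_reindex_bij_betw[OF assms, of "\<lambda>n. (cmod (x n))\<^sup>2"] by (simp add: ell2_def)

definition permutation_operator :: "(nat \<Rightarrow> nat) \<Rightarrow> (nat \<Rightarrow> complex) \<Rightarrow> nat \<Rightarrow> complex" where
  "permutation_operator \<pi> = (\<lambda>x \<in> ell2. \<lambda>m. x (\<pi> m))"

lemma permutation_operator_unitary:
  assumes \<pi>: "bij \<pi>"
  shows "permutation_operator \<pi> \<in> unitary_ops"
proof -
  have "bij_betw (permutation_operator \<pi>) ell2 ell2"
    by (rule bij_betw_byWitness[where f' = "permutation_operator (Hilbert_Choice.inv \<pi>)"])
      (use \<pi> ell2_permute[OF \<pi>] ell2_permute[OF bij_imp_bij_inv[OF \<pi>]] in
        \<open>auto simp: permutation_operator_def bij_is_inj bij_is_surj surj_f_inv_f\<close>)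
  then have "permutation_operator \<pi> \<in> Bij ell2"
    by (simp add: Bij_def permutation_operator_def)
  moreover have "ell2_inner (permutation_operator \<pi> x) (permutation_operator \<pi> y) = ell2_inner x y"
    if "x \<in> ell2" "y \<in> ell2" for x y
    using infsum_reindex_bij_betw[OF \<pi>, of "\<lambda>n. x n * cnj (y n)"] that
    by (simp add: ell2_inner_def permutation_operator_def)
  ultimately show ?thesis
    by (auto simp: unitary_ops_def permutation_operator_def ell2_add ell2_scale)
qed

definition even_coordinates :: "(nat \<Rightarrow> complex) \<Rightarrow> nat \<Rightarrow> complex" where
  "even_coordinates x = (\<lambda>m. if even m then x (m div 2) else 0)"

lemma even_coordinates_square_sum:
  "(\<lambda>m. (cmod (even_coordinates x m))\<^sup>2) summable_on UNIV \<longleftrightarrow> (\<lambda>n. (cmod (x n))\<^sup>2) summable_on UNIV"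
  "(\<Sum>\<^sub>\<infinity>m. (cmod (even_coordinates x m))\<^sup>2) = (\<Sum>\<^sub>\<infinity>n. (cmod (x n))\<^sup>2)"
proof -
  let ?f = "\<lambda>m. (cmod (even_coordinates x m))\<^sup>2"
  have inj: "inj ((*) (2::nat))" by (simp add: inj_def)
  have eq: "?f \<circ> (*) 2 = (\<lambda>n. (cmod (x n))\<^sup>2)" by (simp add: fun_eq_iff even_coordinates_def)
  have zero: "?f m = 0" if "m \<notin> range ((*) 2)" for m
    using that by (auto simp: even_coordinates_def image_iff elim!: evenE)
  have "?f summable_on UNIV \<longleftrightarrow> ?f summable_on range ((*) 2)"
    by (rule summable_on_cong_neutral) (use zero in auto)
  then show "?f summable_on UNIV \<longleftrightarrow> (\<lambda>n. (cmod (x n))\<^sup>2) summable_on UNIV"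
    using summable_on_reindex[OF inj, of ?f] eq by simp
  have "infsum ?f UNIV = infsum ?f (range ((*) 2))"
    by (rule infsum_cong_neutral) (use zero in auto)
  then show "infsum ?f UNIV = (\<Sum>\<^sub>\<infinity>n. (cmod (x n))\<^sup>2)"
    using infsum_reindex[OF inj, of ?f] eq by simp
qed

lemma even_coordinates_ell2: "even_coordinates x \<in> ell2 \<longleftrightarrow> x \<in> ell2"
  and even_coordinates_norm: "ell2_norm (even_coordinates x) = ell2_norm x"
  by (simp_all add: ell2_def ell2_norm_def even_coordinates_square_sum)

lemma ell2_norm_tail:
  assumes x: "x \<in> ell2" and e: "e > 0"
  obtains F where "finite F"
    "\<And>F'. finite F' \<Longrightarrow> F \<subseteq> F' \<Longrightarrow> ell2_norm (\<lambda>n. if n \<in> F' then 0 else x n) < e"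
proof -
  let ?f = "\<lambda>n. (cmod (x n))\<^sup>2"
  have s: "?f summable_on UNIV" using x by (simp add: ell2_def)
  have "(sum ?f \<longlongrightarrow> infsum ?f UNIV) (finite_subsets_at_top UNIV)" by (rule infsum_tendsto[OF s])
  then have "\<forall>\<^sub>F F in finite_subsets_at_top UNIV. infsum ?f UNIV - e\<^sup>2 < sum ?f F"
    by (rule order_tendstoD) (use e in simp)
  then obtain F where F: "finite F"
    "\<And>F'. finite F' \<Longrightarrow> F \<subseteq> F' \<Longrightarrow> infsum ?f UNIV - e\<^sup>2 < sum ?f F'"
    unfolding eventually_finite_subsets_at_top by auto
  have "ell2_norm (\<lambda>n. if n \<in> F' then 0 else x n) < e" if F': "finite F'" "F \<subseteq> F'" for F'
  proof -
    have "(\<Sum>\<^sub>\<infinity>n. (cmod (if n \<in> F' then 0 else x n))\<^sup>2) = infsum ?f (UNIV - F')"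
      by (rule infsum_cong_neutral) auto
    also have "\<dots> = infsum ?f UNIV - infsum ?f F'"
      by (rule infsum_Diff) (use s F' in auto)
    also have "\<dots> < e\<^sup>2" using F(2)[OF F'] F' by simp
    finally show ?thesis
      unfolding ell2_norm_def using e real_sqrt_less_mono by fastforce
  qed
  then show ?thesis using F(1) that by blast
qed

text \<open>
  A permutation operator that moves coordinate \<open>n\<close> to \<open>2 n\<close> for all \<open>n\<close> in a finite set \<open>E\<close> agrees
  with \<open>even_coordinates\<close> on vectors supported in \<open>E\<close>.  Both maps preserve the norm, so on a
  general vector they differ by at most twice the norm of its part outside \<open>E\<close>.
\<close>

lemma even_coordinates_approx:
  assumes A: "finite A" "A \<subseteq> ell2" and e: "e > 0"
  shows "\<exists>U \<in> unitary_ops. \<forall>x \<in> A. ell2_norm (\<lambda>n. U x n - even_coordinates x n) < e"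
proof -
  have "\<exists>F. finite F \<and> (\<forall>F'. finite F' \<longrightarrow> F \<subseteq> F' \<longrightarrow> ell2_norm (\<lambda>n. if n \<in> F' then 0 else x n) < e / 2)"
    if x: "x \<in> A" for x
    using ell2_norm_tail[of x "e / 2"] x A(2) e by (metis half_gt_zero subsetD)
  then obtain F where F: "\<And>x. x \<in> A \<Longrightarrow> finite (F x)"
    "\<And>x F'. x \<in> A \<Longrightarrow> finite F' \<Longrightarrow> F x \<subseteq> F' \<Longrightarrow> ell2_norm (\<lambda>n. if n \<in> F' then 0 else x n) < e / 2"
    by metis
  define E where "E = (\<Union>x\<in>A. F x)"
  have E: "finite E" using A F by (simp add: E_def)
  obtain h where h: "bij h" "\<And>n. n \<in> E \<Longrightarrow> h n = 2 * n"
    using doubling_shift_by_bijection[OF E] by blast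
  define U where "U = permutation_operator (Hilbert_Choice.inv h)"
  have U: "U \<in> unitary_ops"
    unfolding U_def by (rule permutation_operator_unitary[OF bij_imp_bij_inv[OF h(1)]])
  have "ell2_norm (\<lambda>n. U x n - even_coordinates x n) < e" if xA: "x \<in> A" for x
  proof -
    define y where "y = (\<lambda>n. if n \<in> E then 0 else x n)"
    have x: "x \<in> ell2" using xA A by auto
    have "F x \<subseteq> E" using xA by (auto simp: E_def)
    then have small: "ell2_norm y < e / 2" unfolding y_def by (rule F(2)[OF xA E])
    have y: "y \<in> ell2"
      using x unfolding ell2_def y_def mem_Collect_eq
      by (rule summable_on_comparison_test) auto
    have y': "(\<lambda>n. - 1 * y n) \<in> ell2" by (rule ell2_scale[OF y])
    have "U x m - even_coordinates x m = U y m + even_coordinates (\<lambda>n. - 1 * y n) m" for m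
    proof -
      have hm: "h (Hilbert_Choice.inv h m) = m" using h(1) by (simp add: bij_is_surj surj_f_inv_f)
      have "Hilbert_Choice.inv h m \<in> E \<longleftrightarrow> even m \<and> m div 2 \<in> E"
        using h(2)[of "Hilbert_Choice.inv h m"] h(2)[of "m div 2"] hm bij_inv_eq_iff[OF h(1)]
        by (metis dvd_mult_div_cancel dvd_triv_left nonzero_mult_div_cancel_left zero_neq_numeral)
      moreover have "Hilbert_Choice.inv h m = m div 2" if "even m" "m div 2 \<in> E"
        using h(2)[OF that(2)] that(1) h(1) by (metis bij_inv_eq_iff dvd_mult_div_cancel)
      ultimately show ?thesis
        using x y by (auto simp: U_def permutation_operator_def even_coordinates_def y_def)
    qed
    then have "ell2_norm (\<lambda>n. U x n - even_coordinates x n)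
        = ell2_norm (\<lambda>n. U y n + even_coordinates (\<lambda>n. - 1 * y n) n)" by simp
    also have "\<dots> \<le> ell2_norm (U y) + ell2_norm (even_coordinates (\<lambda>n. - 1 * y n))"
      using U y y' by (intro ell2_norm_triangle) (auto simp: even_coordinates_ell2 unitary_ops_def Bij_mem)
    also have "\<dots> = ell2_norm y + ell2_norm y"
      using unitary_ops_norm[OF U y] by (simp add: even_coordinates_norm) (simp add: ell2_norm_def)
    finally show ?thesis using small by simp
  qed
  then show ?thesis using U by blast
qed

text \<open>
  The permutations used for \<open>S\<^sub>\<infinity>\<close> act on coordinates: they fix vectors whose odd coordinates
  vanish and send the unit vector \<open>e\<^sub>1\<close> to the vectors \<open>e\<^sub>2\<^sub>k\<^sub>+\<^sub>3\<close>.
\<close>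

lemma unitary_stabilized_limit:
  "\<exists>(I :: ((nat \<Rightarrow> complex) set \<times> real) set) N D.
    noncompactly_stabilized_limit unitary_group unitary_strong_topology I N D"
proof -
  let ?g = "\<lambda>k. permutation_operator (Transposition.transpose 1 (2 * k + 3))"
  define x :: "nat \<Rightarrow> complex" where "x = (\<lambda>n. if n = 1 then 1 else 0)"
  have x: "x \<in> ell2"
  proof -
    have "(\<lambda>n. (cmod (x n))\<^sup>2) summable_on {1}" by simp
    then have "(\<lambda>n. (cmod (x n))\<^sup>2) summable_on UNIV"
      by (rule summable_on_cong_neutral[THEN iffD1, rotated -1]) (auto simp: x_def)
    then show ?thesis by (simp add: ell2_def)
  qed
  have g: "?g k \<in> unitary_ops" for k by (rule permutation_operator_unitary) simp
  have gx: "?g k x \<in> ell2" for k using g[of k] x by (auto simp: unitary_ops_def Bij_mem)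
  have "noncompactly_stabilized_limit (perm_group (mspace ell2_metric) unitary_ops)
    (pointwise_topology (mtopology_of ell2_metric) unitary_ops)
    {(A, e). finite A \<and> A \<subseteq> mspace ell2_metric \<and> e > 0}
    (\<lambda>(A, e). {h \<in> unitary_ops. \<forall>x \<in> A. mdist ell2_metric (h x) (even_coordinates x) < e}) (range ?g)"
  proof (rule noncompactly_stabilized_limit_pointwise[OF _ unitary_ops_isometries])
    show "group (perm_group (mspace ell2_metric) unitary_ops)"
      using group_unitary_group by (simp add: unitary_group_def mspace_ell2_metric)
    show "even_coordinates \<in> mspace ell2_metric \<rightarrow> mspace ell2_metric"
      by (simp add: mspace_ell2_metric even_coordinates_ell2)
    show "\<exists>h\<in>unitary_ops. \<forall>x\<in>A. mdist ell2_metric (h x) (even_coordinates x) < e"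
      if "finite A" "A \<subseteq> mspace ell2_metric" "e > 0" for A e
      using even_coordinates_approx[of A e] that by (simp add: mspace_ell2_metric mdist_ell2_metric)
    show "?g k \<in> unitary_ops" for k by (rule g)
    show "?g k (even_coordinates x) = even_coordinates x" if "x \<in> mspace ell2_metric" for k x
    proof -
      have "even_coordinates x (Transposition.transpose 1 (2 * k + 3) m) = even_coordinates x m" for m
        by (auto simp: even_coordinates_def Transposition.transpose_def)
      then show ?thesis
        using that by (simp add: permutation_operator_def mspace_ell2_metric even_coordinates_ell2)
    qed
    show "x \<in> mspace ell2_metric" using x by (simp add: mspace_ell2_metric)
    show "0 < (1::real)" by simp
    show "1 \<le> mdist ell2_metric (?g j x) (?g k x)" if "j \<noteq> k" for j k
    proof -
      have "?g j x (2 * j + 3) - ?g k x (2 * j + 3) = 1"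
        using that x by (auto simp: permutation_operator_def x_def Transposition.transpose_def)
      then show ?thesis
        using cmod_le_ell2_norm[OF ell2_diff[OF gx[of j] gx[of k]], of "2 * j + 3"]
        by (simp add: mdist_ell2_metric)
    qed
  qed
  then show ?thesis
    unfolding unitary_group_def unitary_strong_topology_def mspace_ell2_metric by blast
qed

section \<open>Extending isometries from a dense sequence\<close>

definition dense_sequence :: "'a metric \<Rightarrow> (nat \<Rightarrow> 'a) \<Rightarrow> bool" where
  "dense_sequence U q \<longleftrightarrow>
     (\<forall>n. q n \<in> mspace U) \<and> (\<forall>x \<in> mspace U. \<forall>e>0. \<exists>n. mdist U (q n) x < e)"

context
  fixes U :: "'u metric" and q :: "nat \<Rightarrow> 'u"
  assumes complete: "mcomplete_of U" and dense_seq: "dense_sequence U q"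
begin

private lemma q: "q n \<in> mspace U"
  using dense_seq by (simp add: dense_sequence_def)

private lemma dense: "x \<in> mspace U \<Longrightarrow> e > 0 \<Longrightarrow> \<exists>n. mdist U (q n) x < e"
  using dense_seq by (simp add: dense_sequence_def)

interpretation Metric_space "mspace U" "mdist U" by simp

text \<open>
  The image of \<open>x\<close> is the limit of \<open>w (s i)\<close> where \<open>q (s i)\<close> tends to \<open>x\<close>.  It is
  characterised by its distances to all \<open>w n\<close>, and these determine distances between images by
  density of \<open>q\<close>.
\<close>

lemma dense_copy_extends:
  assumes w: "\<And>n. w n \<in> mspace U" "\<And>i j. mdist U (w i) (w j) = mdist U (q i) (q j)"
  obtains \<zeta> where "\<zeta> \<in> mspace U \<rightarrow> mspace U" "\<And>n. \<zeta> (q n) = w n"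
    "\<And>x y. x \<in> mspace U \<Longrightarrow> y \<in> mspace U \<Longrightarrow> mdist U (\<zeta> x) (\<zeta> y) = mdist U x y"
proof -
  have "\<exists>y \<in> mspace U. \<forall>n. mdist U y (w n) = mdist U x (q n)" if x: "x \<in> mspace U" for x
  proof -
    have "\<exists>n. mdist U (q n) x < inverse (real (Suc i))" for i
      by (rule dense[OF x]) simp
    then obtain s where s: "\<And>i. mdist U (q (s i)) x < inverse (real (Suc i))" by metis
    have near: "mdist U (q (s i)) x < e" if "inverse (real (Suc n)) < e" "n \<le> i" for i n e
    proof -
      have "inverse (real (Suc i)) \<le> inverse (real (Suc n))" using that(2) by (simp add: field_simps)
      then show ?thesis using s[of i] that(1) by linarith
    qed
    have "MCauchy (\<lambda>i. w (s i))"
      unfolding MCauchy_def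
    proof (intro conjI allI impI)
      show "range (\<lambda>i. w (s i)) \<subseteq> mspace U" using w(1) by blast
      fix e :: real assume "e > 0"
      then obtain n where n: "inverse (real (Suc n)) < e/2" using reals_Archimedean[of "e/2"] by auto
      show "\<exists>n. \<forall>i j. n \<le> i \<longrightarrow> n \<le> j \<longrightarrow> mdist U (w (s i)) (w (s j)) < e"
      proof (intro exI[of _ n] allI impI)
        fix i j assume "n \<le> i" "n \<le> j"
        then show "mdist U (w (s i)) (w (s j)) < e"
          using near[OF n, of i] near[OF n, of j] triangle[OF q[of "s i"] x q[of "s j"]]
          by (simp add: w(2) commute)
      qed
    qed
    then obtain y where "limitin mtopology (\<lambda>i. w (s i)) y sequentially"
      using complete by (auto simp: mcomplete_of_def mcomplete_def)
    then have y: "y \<in> mspace U" and lim: "\<forall>e>0. \<exists>N. \<forall>i\<ge>N. mdist U (w (s i)) y < e"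
      unfolding limit_metric_sequentially by blast+
    have "mdist U y (w n) = mdist U x (q n)" for n
    proof -
      have "\<bar>mdist U y (w n) - mdist U x (q n)\<bar> \<le> e" if e: "e > 0" for e
      proof -
        obtain N where N: "\<forall>i\<ge>N. mdist U (w (s i)) y < e/2" using lim e by (meson half_gt_zero)
        obtain M where M: "inverse (real (Suc M)) < e/2" using reals_Archimedean[of "e/2"] e by auto
        define i where "i = max N M"
        have "mdist U (w (s i)) y < e/2" using N by (simp add: i_def)
        moreover have "mdist U (q (s i)) x < e/2" by (rule near[OF M]) (simp add: i_def)
        ultimately show ?thesis
          using triangle[OF y w(1)[of "s i"] w(1)[of n]] triangle[OF w(1)[of "s i"] y w(1)[of n]]
            triangle[OF x q[of "s i"] q[of n]] triangle[OF q[of "s i"] x q[of n]]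
          by (simp add: w(2) commute abs_if)
      qed
      then have "\<bar>mdist U y (w n) - mdist U x (q n)\<bar> \<le> 0"
        by (rule field_le_epsilon[of _ 0, simplified])
      then show ?thesis by simp
    qed
    then show ?thesis using y by blast
  qed
  then obtain \<zeta> where \<zeta>: "\<And>x. x \<in> mspace U \<Longrightarrow> \<zeta> x \<in> mspace U"
    "\<And>x n. x \<in> mspace U \<Longrightarrow> mdist U (\<zeta> x) (w n) = mdist U x (q n)" by metis
  show ?thesis
  proof (rule that[of \<zeta>])
    show "\<zeta> \<in> mspace U \<rightarrow> mspace U" using \<zeta>(1) by blast
    show "\<zeta> (q n) = w n" for n using \<zeta>(2)[of "q n" n] \<zeta>(1)[OF q] q w(1) by simp
    fix x y assume xy: "x \<in> mspace U" "y \<in> mspace U"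
    have "\<bar>mdist U (\<zeta> x) (\<zeta> y) - mdist U x y\<bar> \<le> e" if e: "e > 0" for e
    proof -
      obtain n where n: "mdist U (q n) y < e/2" using dense[OF xy(2), of "e/2"] e by auto
      then have "mdist U (\<zeta> y) (w n) < e/2" using \<zeta>(2)[OF xy(2)] by (simp add: commute)
      then show ?thesis
        using n \<zeta>(2)[OF xy(1), of n]
          triangle[OF \<zeta>(1)[OF xy(1)] w(1)[of n] \<zeta>(1)[OF xy(2)]]
          triangle[OF \<zeta>(1)[OF xy(1)] \<zeta>(1)[OF xy(2)] w(1)[of n]]
          triangle[OF xy(1) q[of n] xy(2)] triangle[OF xy(1) xy(2) q[of n]]
        by (simp add: commute abs_if)
    qed
    then have "\<bar>mdist U (\<zeta> x) (\<zeta> y) - mdist U x y\<bar> \<le> 0"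
      by (rule field_le_epsilon[of _ 0, simplified])
    then show "mdist U (\<zeta> x) (\<zeta> y) = mdist U x y" by simp
  qed
qed

lemma isometries_agreeing_on_dense:
  assumes f: "f \<in> mspace U \<rightarrow> mspace U" "\<And>x y. x \<in> mspace U \<Longrightarrow> y \<in> mspace U \<Longrightarrow> mdist U (f x) (f y) = mdist U x y"
    and g: "g \<in> mspace U \<rightarrow> mspace U" "\<And>x y. x \<in> mspace U \<Longrightarrow> y \<in> mspace U \<Longrightarrow> mdist U (g x) (g y) = mdist U x y"
    and eq: "\<And>n. f (q n) = g (q n)" and x: "x \<in> mspace U"
  shows "f x = g x"
proof -
  have fg: "f x \<in> mspace U" "g x \<in> mspace U" "f (q n) \<in> mspace U" for n using f(1) g(1) x q by auto
  have "mdist U (f x) (g x) \<le> e" if e: "e > 0" for e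
  proof -
    obtain n where n: "mdist U (q n) x < e/2" using dense[OF x, of "e/2"] e by auto
    then show ?thesis
      using triangle[OF fg(1) fg(3)[of n] fg(2)] f(2)[OF x q[of n]] g(2)[OF q[of n] x] eq[of n]
      by (simp add: commute)
  qed
  then have "mdist U (f x) (g x) \<le> 0" by (rule field_le_epsilon[of _ 0, simplified])
  then show ?thesis using fg nonneg[of "f x" "g x"] by simp
qed

text \<open>
  A pointwise limit of isometries is an isometric embedding; it is onto when the inverses converge
  too.  Eventually constant values and inverse images at the \<open>q n\<close> give both kinds of convergence.
\<close>

lemma limit_isometry:
  fixes h :: "nat \<Rightarrow> 'u \<Rightarrow> 'u"
  assumes h: "\<And>m. h m \<in> isometries U"
    and eventual_value: "\<And>n. \<exists>v N. \<forall>m\<ge>N. h m (q n) = v"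
    and preimage: "\<And>n. \<exists>y \<in> mspace U. \<exists>N. \<forall>m\<ge>N. h m y = q n"
  obtains f where "f \<in> isometries U"
    "\<And>u v N. u \<in> mspace U \<Longrightarrow> \<forall>m\<ge>N. h m u = v \<Longrightarrow> f u = v"
proof -
  have h_in: "h m x \<in> mspace U" if "x \<in> mspace U" for m x
    using h[of m] that Bij_mem[of "h m" "mspace U" x] by (simp add: isometries_def)
  have h_iso: "mdist U (h m x) (h m y) = mdist U x y" if "x \<in> mspace U" "y \<in> mspace U" for m x y
    using h[of m] that by (simp add: isometries_def)
  obtain w N where w: "\<And>n m. m \<ge> N n \<Longrightarrow> h m (q n) = w n" using eventual_value by metis
  obtain y M where y: "\<And>n. y n \<in> mspace U" "\<And>n m. m \<ge> M n \<Longrightarrow> h m (y n) = q n" using preimage by metis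
  have "w n \<in> mspace U" for n using h_in[OF q[of n], of "N n"] unfolding w[OF order_refl] .
  moreover have "mdist U (w i) (w j) = mdist U (q i) (q j)" for i j
    using w[of i "max (N i) (N j)"] w[of j "max (N i) (N j)"] h_iso[OF q q, of "max (N i) (N j)" i j] by simp
  ultimately obtain f where f: "f \<in> mspace U \<rightarrow> mspace U" "\<And>n. f (q n) = w n"
    "\<And>x y. x \<in> mspace U \<Longrightarrow> y \<in> mspace U \<Longrightarrow> mdist U (f x) (f y) = mdist U x y"
    by (rule dense_copy_extends[of w]) (erule that; simp)
  have eventual: "f u = v" if u: "u \<in> mspace U" and v: "\<forall>m\<ge>K. h m u = v" for u v K
  proof -
    have vU: "v \<in> mspace U" using v h_in[OF u, of K] by auto
    have fu: "f u \<in> mspace U" using f(1) u by blast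
    have "mdist U (f u) v \<le> e" if e: "e > 0" for e
    proof -
      obtain n where n: "mdist U (q n) u < e/2" using dense[OF u, of "e/2"] e by auto
      have wn: "w n \<in> mspace U" using f(1,2) q[of n] by (metis Pi_mem)
      have "mdist U (w n) v = mdist U (q n) u"
        using w[of n "max K (N n)"] spec[OF v, of "max K (N n)"] h_iso[OF q u, of "max K (N n)" n] by simp
      moreover have "mdist U (f u) (w n) = mdist U u (q n)" using f(3)[OF u q[of n]] f(2) by simp
      ultimately show ?thesis
        using triangle[OF fu wn vU] n by (simp add: commute)
    qed
    then have "mdist U (f u) v \<le> 0" by (rule field_le_epsilon[of _ 0, simplified])
    then show ?thesis using fu vU nonneg[of "f u" v] by simp
  qed
  have fy: "f (y n) = q n" for n by (rule eventual[OF y(1)]) (use y(2) in blast)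
  have "mdist U (y i) (y j) = mdist U (q i) (q j)" for i j
    using f(3)[OF y(1)[of i] y(1)[of j]] by (simp add: fy)
  then obtain f' where f': "f' \<in> mspace U \<rightarrow> mspace U" "\<And>n. f' (q n) = y n"
    "\<And>x y. x \<in> mspace U \<Longrightarrow> y \<in> mspace U \<Longrightarrow> mdist U (f' x) (f' y) = mdist U x y"
    by (rule dense_copy_extends[of y, OF y(1)]) (erule that; simp)
  have inverse: "f (f' x) = x" if "x \<in> mspace U" for x
  proof (rule isometries_agreeing_on_dense[of "\<lambda>x. f (f' x)" "\<lambda>x. x", OF _ _ _ _ _ that])
    show "mdist U (f (f' x)) (f (f' y)) = mdist U x y" if "x \<in> mspace U" "y \<in> mspace U" for x y
      using f(1,3) f'(1,3) that by (simp add: Pi_iff)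
  qed (use f(1) f'(1,2) fy in auto)
  have "inj_on f (mspace U)"
  proof (rule inj_onI)
    fix a b assume ab: "a \<in> mspace U" "b \<in> mspace U" "f a = f b"
    then have "f a \<in> mspace U" using f(1) by blast
    then show "a = b" using f(3)[OF ab(1,2)] ab by simp
  qed
  moreover have "f ` mspace U = mspace U"
  proof
    show "mspace U \<subseteq> f ` mspace U"
    proof
      fix x assume x: "x \<in> mspace U"
      then have "f' x \<in> mspace U" using f'(1) by blast
      then show "x \<in> f ` mspace U" using inverse[OF x] by (metis image_eqI)
    qed
  qed (use f(1) in blast)
  ultimately have "restrict f (mspace U) \<in> Bij (mspace U)"
    by (simp add: Bij_def bij_betw_def)
  then have "restrict f (mspace U) \<in> isometries U" using f(3) by (simp add: isometries_def)
  then show ?thesis by (rule that) (use eventual in auto)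
qed

end

section \<open>The Urysohn sphere\<close>

lemma urysohn_sphere_mdist_le_1:
  assumes "urysohn_sphere U" "x \<in> mspace U" "y \<in> mspace U"
  shows "mdist U x y \<le> 1"
proof -
  have "ereal (mdist U x y) \<le> metric_diameter U"
    unfolding metric_diameter_def using assms(2,3) by (intro SUP_upper2[of "(x, y)"]) auto
  then show ?thesis using assms(1) by (simp add: urysohn_sphere_def)
qed

lemma urysohn_sphere_homogeneous:
  assumes U: "urysohn_sphere U" and A: "finite A" "A \<subseteq> mspace U"
    and f: "\<And>x. x \<in> A \<Longrightarrow> f x \<in> mspace U"
      "\<And>x y. x \<in> A \<Longrightarrow> y \<in> A \<Longrightarrow> mdist U (f x) (f y) = mdist U x y"
  obtains h where "h \<in> isometries U" "\<And>x. x \<in> A \<Longrightarrow> h x = f x"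
proof -
  have "isometric_embedding (submetric U A) U f"
    using A f by (auto simp: isometric_embedding_def)
  then have "\<exists>h \<in> isometries U. \<forall>x \<in> A. h x = f x"
    using U A by (simp add: urysohn_sphere_def)
  then show ?thesis using that by blast
qed

text \<open>
  The hypotheses on \<open>f\<close> are the triangle inequalities of a metric on \<open>A\<close> plus one new point at
  distance \<open>f a\<close> from each \<open>a\<close>.  Universality realises this metric inside \<open>U\<close>, and
  homogeneity moves the copy of \<open>A\<close> back to \<open>A\<close>.
\<close>

lemma urysohn_sphere_one_point_extension:
  assumes U: "urysohn_sphere U" and A: "finite A" "A \<subseteq> mspace U"
    and f: "\<And>a. a \<in> A \<Longrightarrow> f a \<le> 1"
      "\<And>a b. a \<in> A \<Longrightarrow> b \<in> A \<Longrightarrow> f a \<le> f b + mdist U a b"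
      "\<And>a b. a \<in> A \<Longrightarrow> b \<in> A \<Longrightarrow> mdist U a b \<le> f a + f b"
  obtains p where "p \<in> mspace U" "\<And>a. a \<in> A \<Longrightarrow> mdist U p a = f a"
proof -
  interpret Metric_space "mspace U" "mdist U" by simp
  have nn: "f a \<ge> 0" if "a \<in> A" for a using f(3)[OF that that] that A by auto
  show ?thesis
  \<comment> \<open>If \<open>f\<close> vanishes at \<open>a\<close>, the new point has to coincide with
      \<open>a\<close>.\<close>
  proof (cases "\<exists>a \<in> A. f a = 0")
    case True
    then obtain a where a: "a \<in> A" "f a = 0" by blast
    show ?thesis
    proof (rule that[of a])
      show "mdist U a b = f b" if "b \<in> A" for b
        using f(2)[OF that a(1)] f(3)[OF a(1) that] a(2) by (simp add: commute)
    qed (use a A in auto)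
  next
    case False
    then have pos: "f a > 0" if "a \<in> A" for a using nn[OF that] that by force
    \<comment> \<open>The test spaces of the universality clause are sets of reals: code \<open>A\<close> by
        naturals and the new point by \<open>-1\<close>.\<close>
    obtain c :: "'a \<Rightarrow> nat" where c: "inj_on c A"
      using finite_imp_inj_to_nat_seg[OF A(1)] by blast
    define code where "code a = real (c a)" for a
    have code: "inj_on code A" using c by (auto simp: code_def inj_on_def)
    define dec where "dec = inv_into A code"
    have dec: "dec (code a) = a" if "a \<in> A" for a using that code by (simp add: dec_def)
    define D where "D s t = (if s = t then 0 else if s = -1 then \<bar>f (dec t)\<bar> else if t = -1 then \<bar>f (dec s)\<bar>
      else mdist U (dec s) (dec t))" for s t :: real
    define Y where "Y = insert (-1) (code ` A)"
    have ne: "code a \<noteq> -1" "-1 \<noteq> code a" for a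
      using of_nat_0_le_iff[of "c a"] unfolding code_def by linarith+
    have D1: "D (-1) (code a) = f a" "D (code a) (-1) = f a" if "a \<in> A" for a
      using that ne nn by (auto simp: D_def dec)
    have D0: "D (-1) (-1) = 0" by (simp add: D_def)
    have D2: "D (code a) (code b) = mdist U a b" if "a \<in> A" "b \<in> A" for a b
      using that ne A by (auto simp: D_def dec inj_on_eq_iff[OF code] subset_iff)
    have cases: thesis if "s \<in> Y" "s = -1 \<Longrightarrow> thesis" "\<And>a. a \<in> A \<Longrightarrow> s = code a \<Longrightarrow> thesis" for s thesis
      using that by (auto simp: Y_def)
    have triangle_code: "mdist U a b \<le> mdist U a e + mdist U e b" if "a \<in> A" "b \<in> A" "e \<in> A" for a b e
      using triangle that A by blast
    have Y: "Metric_space Y D"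
    proof
      show "0 \<le> D x y" for x y by (simp add: D_def)
      show "D x y = D y x" for x y by (simp add: D_def commute)
      show "(D x y = 0) = (x = y)" if x: "x \<in> Y" and y: "y \<in> Y" for x y
      proof (rule cases[OF x]; rule cases[OF y])
        fix a b assume "a \<in> A" "b \<in> A" "x = code a" "y = code b"
        then show ?thesis using A inj_on_eq_iff[OF code] by (simp add: D2 subset_iff)
      next
        fix a assume "a \<in> A" "x = - 1" "y = code a"
        then show ?thesis using pos[of a] ne[of a] D1[of a] by simp
      next
        fix a assume "a \<in> A" "x = code a" "y = - 1"
        then show ?thesis using pos[of a] ne[of a] D1[of a] by simp
      qed (simp add: D0)
      show "D x z \<le> D x y + D y z" if x: "x \<in> Y" and y: "y \<in> Y" and z: "z \<in> Y" for x y z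
      proof (rule cases[OF x]; rule cases[OF y]; rule cases[OF z])
        show ?thesis if "x = -1" "y = -1" "z = -1" using that by (simp add: D0)
        show ?thesis if "x = -1" "y = -1" "a \<in> A" "z = code a" for a using that by (simp add: D0)
        show ?thesis if "x = -1" "a \<in> A" "y = code a" "z = -1" for a
          using that nn[of a] by (simp add: D0 D1)
        show ?thesis if "x = -1" "a \<in> A" "y = code a" "b \<in> A" "z = code b" for a b
          using that f(2)[of b a] by (simp add: D1 D2 commute)
        show ?thesis if "a \<in> A" "x = code a" "y = -1" "z = -1" for a using that by (simp add: D0)
        show ?thesis if "a \<in> A" "x = code a" "y = -1" "b \<in> A" "z = code b" for a b
          using that f(3)[of a b] by (simp add: D1 D2)
        show ?thesis if "a \<in> A" "x = code a" "b \<in> A" "y = code b" "z = -1" for a b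
          using that f(2)[of a b] by (simp add: D1 D2)
        show ?thesis if "a \<in> A" "x = code a" "b \<in> A" "y = code b" "e \<in> A" "z = code e" for a b e
          using that triangle_code[of a e b] by (simp add: D2)
      qed
    qed
    have D_le: "D x y \<le> 1" if x: "x \<in> Y" and y: "y \<in> Y" for x y
    proof (rule cases[OF x]; rule cases[OF y])
      show ?thesis if "a \<in> A" "x = code a" "b \<in> A" "y = code b" for a b
        using that urysohn_sphere_mdist_le_1[OF U, of a b] A by (auto simp: D2)
    qed (simp_all add: D0 D1 f(1))
    define M where "M = metric (Y, D)"
    have M: "mspace M = Y" "mdist M = D"
      using Y by (simp_all add: M_def Metric_space.mspace_metric Metric_space.mdist_metric)
    have "separable_space (mtopology_of M)"
      unfolding separable_space_def
      using A(1) by (intro exI[of _ Y]) (auto simp: M Y_def countable_finite closure_of_topspace[of "mtopology_of M", unfolded topspace_mtopology_of M Y_def])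
    moreover have "metric_diameter M \<le> 1"
      unfolding metric_diameter_def by (rule SUP_least) (auto simp: M D_le)
    ultimately obtain e where e: "isometric_embedding M U e"
      using U by (auto simp: urysohn_sphere_def)
    have eU: "e s \<in> mspace U" if "s \<in> Y" for s
      using e that by (auto simp: isometric_embedding_def M)
    have ed: "mdist U (e s) (e t) = D s t" if "s \<in> Y" "t \<in> Y" for s t
      using e that by (auto simp: isometric_embedding_def M)
    have codeY: "code a \<in> Y" if "a \<in> A" for a using that by (simp add: Y_def)
    define decode where "decode = inv_into A (\<lambda>a. e (code a))"
    have "inj_on (\<lambda>a. e (code a)) A"
    proof (rule inj_onI)
      fix a b assume ab: "a \<in> A" "b \<in> A" "e (code a) = e (code b)"
      then have "mdist U a b = 0" using ed[of "code a" "code b"] eU[of "code b"] by (simp add: codeY D2)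
      then show "a = b" using zero[of a b] ab(1,2) A(2) by (simp add: subset_iff)
    qed
    then have decode: "decode (e (code a)) = a" if "a \<in> A" for a
      using inv_into_f_f[of "\<lambda>a. e (code a)" A a] that by (simp add: decode_def)
    obtain h where h: "h \<in> isometries U" "\<And>x. x \<in> (\<lambda>a. e (code a)) ` A \<Longrightarrow> h x = decode x"
    proof (rule urysohn_sphere_homogeneous[OF U, of "(\<lambda>a. e (code a)) ` A" decode])
      show "(\<lambda>a. e (code a)) ` A \<subseteq> mspace U" using eU codeY by blast
      show "decode x \<in> mspace U" if "x \<in> (\<lambda>a. e (code a)) ` A" for x using that decode A by auto
      show "mdist U (decode x) (decode y) = mdist U x y"
        if "x \<in> (\<lambda>a. e (code a)) ` A" "y \<in> (\<lambda>a. e (code a)) ` A" for x y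
        using that decode by (auto simp: ed codeY D2)
    qed (use A in auto)
    have new: "-1 \<in> Y" by (simp add: Y_def)
    show ?thesis
    proof (rule that[of "h (e (-1))"])
      show "h (e (-1)) \<in> mspace U"
        using h(1) eU[OF new] Bij_mem[of h "mspace U"] by (simp add: isometries_def)
      fix a assume a: "a \<in> A"
      then have "h (e (code a)) = a" using h(2)[of "e (code a)"] decode by simp
      then have "mdist U (h (e (-1))) a = mdist U (e (-1)) (e (code a))"
        using h(1) eU[OF new] eU[OF codeY[OF a]] unfolding isometries_def
        by (metis (mono_tags, lifting) mem_Collect_eq)
      then show "mdist U (h (e (-1))) a = f a" using ed[OF new codeY[OF a]] D1(1)[OF a] by simp
    qed
  qed
qed

text \<open>
  Continues the copy \<open>z\<close> of \<open>q\<close> by a point \<open>p\<close> whose distance to each point \<open>x\<close> of \<open>B\<close> is as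
  large as the copy permits, that is, the minimum of 1 and all
  \<open>d (z i) x + d (q i) (q n)\<close>.  This distance depends only on the distances of \<open>x\<close> to the \<open>z i\<close>,
  so \<open>p\<close> does not distinguish \<open>x\<close> from its image under an isometry that fixes every \<open>z i\<close>; on
  any part of \<open>B\<close> that it maps into \<open>B\<close>, such an isometry can thus be extended by \<open>p \<mapsto> p\<close>.
\<close>

lemma urysohn_sphere_commonly_fixed_extension:
  fixes n :: nat
  assumes U: "urysohn_sphere U" and B: "finite B" "B \<subseteq> mspace U"
    and z: "\<And>i. i < n \<Longrightarrow> z i \<in> B" and q: "\<And>i. q i \<in> mspace U"
    and zq: "\<And>i j. i < n \<Longrightarrow> j < n \<Longrightarrow> mdist U (z i) (z j) = mdist U (q i) (q j)"
  obtains p where "p \<in> mspace U" "\<And>i. i < n \<Longrightarrow> mdist U p (z i) = mdist U (q n) (q i)"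
    "\<And>x y. x \<in> B \<Longrightarrow> y \<in> B \<Longrightarrow> (\<And>i. i < n \<Longrightarrow> mdist U (z i) x = mdist U (z i) y) \<Longrightarrow> mdist U p x = mdist U p y"
    "\<And>x. x \<in> B \<Longrightarrow> (\<And>i. i < n \<Longrightarrow> mdist U (z i) x = 1) \<Longrightarrow> mdist U p x = 1"
proof -
  interpret Metric_space "mspace U" "mdist U" by simp
  let ?d = "mdist U"
  have zU: "z i \<in> mspace U" if "i < n" for i using z[OF that] B by blast
  define f where "f x = Min (insert 1 ((\<lambda>i. ?d (z i) x + ?d (q i) (q n)) ` {..<n}))" for x
  have f_le1: "f x \<le> 1" for x unfolding f_def by (rule Min_le) auto
  have f_le: "f x \<le> ?d (z i) x + ?d (q i) (q n)" if "i < n" for x i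
    unfolding f_def by (rule Min_le) (use that in auto)
  have f_cases: "f x = 1 \<or> (\<exists>i<n. f x = ?d (z i) x + ?d (q i) (q n))" for x
  proof -
    have "f x \<in> insert 1 ((\<lambda>i. ?d (z i) x + ?d (q i) (q n)) ` {..<n})"
      unfolding f_def by (rule Min_in) auto
    then show ?thesis by auto
  qed
  have f_nonneg: "f x \<ge> 0" for x using f_cases[of x] by (auto intro: add_nonneg_nonneg)
  obtain p where p: "p \<in> mspace U" "\<And>a. a \<in> B \<Longrightarrow> ?d p a = f a"
  proof (rule urysohn_sphere_one_point_extension[OF U B, of f])
    show "f a \<le> 1" for a by (rule f_le1)
    fix a b assume "a \<in> B" "b \<in> B"
    then have ab: "a \<in> mspace U" "b \<in> mspace U" using B by auto
    show "f a \<le> f b + ?d a b"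
    proof (cases "f b = 1")
      case True
      then show ?thesis using f_le1[of a] nonneg[of a b] by linarith
    next
      case False
      then obtain i where i: "i < n" "f b = ?d (z i) b + ?d (q i) (q n)" using f_cases[of b] by blast
      then show ?thesis
        using f_le[OF i(1), of a] triangle[OF zU[OF i(1)] ab(2,1)] by (simp add: commute)
    qed
    show "?d a b \<le> f a + f b"
    proof (cases "f a = 1 \<or> f b = 1")
      case True
      then show ?thesis
        using urysohn_sphere_mdist_le_1[OF U ab] f_nonneg[of a] f_nonneg[of b] by auto
    next
      case False
      then obtain i j where i: "i < n" "f a = ?d (z i) a + ?d (q i) (q n)"
        and j: "j < n" "f b = ?d (z j) b + ?d (q j) (q n)" using f_cases by blast
      have "?d a b \<le> ?d a (z i) + (?d (z i) (z j) + ?d (z j) b)"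
        using triangle[OF ab(1) zU[OF i(1)] ab(2)] triangle[OF zU[OF i(1)] zU[OF j(1)] ab(2)] by linarith
      also have "?d (z i) (z j) \<le> ?d (q i) (q n) + ?d (q n) (q j)"
        using zq[OF i(1) j(1)] triangle[OF q q q] by simp
      finally show ?thesis using i(2) j(2) by (simp add: commute)
    qed
  qed (erule that; blast)
  show ?thesis
  proof (rule that[OF p(1)])
    show "?d p (z j) = ?d (q n) (q j)" if j: "j < n" for j
    proof (rule antisym)
      show "?d p (z j) \<le> ?d (q n) (q j)"
        using f_le[OF j, of "z j"] p(2)[OF z[OF j]] zU[OF j] by (simp add: commute)
      show "?d (q n) (q j) \<le> ?d p (z j)"
        using f_cases[of "z j"]
      proof (elim disjE exE conjE)
        assume "f (z j) = 1"
        then show ?thesis using p(2)[OF z[OF j]] urysohn_sphere_mdist_le_1[OF U q q] by simp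
      next
        fix i assume i: "i < n" "f (z j) = ?d (z i) (z j) + ?d (q i) (q n)"
        then show ?thesis
          using p(2)[OF z[OF j]] zq[OF i(1) j] triangle[OF q[of n] q[of i] q[of j]] by (simp add: commute)
      qed
    qed
    show "?d p x = ?d p y" if "x \<in> B" "y \<in> B" "\<And>i. i < n \<Longrightarrow> ?d (z i) x = ?d (z i) y" for x y
    proof -
      have "(\<lambda>i. ?d (z i) x + ?d (q i) (q n)) ` {..<n} = (\<lambda>i. ?d (z i) y + ?d (q i) (q n)) ` {..<n}"
        by (rule image_cong) (use that(3) in auto)
      then show ?thesis using p(2) that(1,2) by (simp add: f_def)
    qed
    show "?d p x = 1" if "x \<in> B" "\<And>i. i < n \<Longrightarrow> ?d (z i) x = 1" for x
      using f_cases[of x]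
    proof (elim disjE exE conjE)
      fix i assume "i < n" "f x = ?d (z i) x + ?d (q i) (q n)"
      then show ?thesis
        using f_le1[of x] p(2)[OF that(1)] that(2)[of i] nonneg[of "q i" "q n"] by linarith
    qed (use p(2)[OF that(1)] in simp)
  qed
qed

text \<open>
  A state \<open>(z, g, A)\<close> at stage \<open>n\<close> consists of the first \<open>n\<close> points \<open>z i\<close> of a copy of \<open>q\<close>, of
  \<open>n\<close> isometries \<open>g k\<close> that fix these points, and of a finite set \<open>A\<close> on which later stages must
  not change the \<open>g k\<close> or their inverses.  Values of \<open>z\<close> and \<open>g\<close> from \<open>n\<close> on are arbitrary.
  Keeping \<open>z i\<close> at distance 1 from \<open>x\<^sub>0\<close> leaves \<open>x\<^sub>0\<close> free to be moved to any point at distance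
  1 from all \<open>z i\<close>.
\<close>

definition stage ::
    "'u metric \<Rightarrow> (nat \<Rightarrow> 'u) \<Rightarrow> 'u \<Rightarrow> nat \<Rightarrow> (nat \<Rightarrow> 'u) \<times> (nat \<Rightarrow> 'u \<Rightarrow> 'u) \<times> 'u set \<Rightarrow> bool" where
  "stage U q x\<^sub>0 n = (\<lambda>(z, g, A). finite A \<and> A \<subseteq> mspace U \<and> x\<^sub>0 \<in> A \<and>
     (\<forall>i<n. z i \<in> mspace U \<and> mdist U x\<^sub>0 (z i) = 1) \<and>
     (\<forall>i<n. \<forall>j<n. mdist U (z i) (z j) = mdist U (q i) (q j)) \<and>
     (\<forall>k<n. g k \<in> isometries U \<and> (\<forall>i<n. g k (z i) = z i)) \<and>
     (\<forall>j<n. \<forall>k<n. j \<noteq> k \<longrightarrow> mdist U (g j x\<^sub>0) (g k x\<^sub>0) = 1))"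

text \<open>
  The clause about \<open>y\<close> says that \<open>g k\<close> and \<open>g' k\<close> have the same inverse image of each \<open>x \<in> A\<close>.
\<close>

definition refines ::
    "'u metric \<Rightarrow> (nat \<Rightarrow> 'u) \<Rightarrow> nat \<Rightarrow> (nat \<Rightarrow> 'u) \<times> (nat \<Rightarrow> 'u \<Rightarrow> 'u) \<times> 'u set \<Rightarrow>
      (nat \<Rightarrow> 'u) \<times> (nat \<Rightarrow> 'u \<Rightarrow> 'u) \<times> 'u set \<Rightarrow> bool" where
  "refines U q n = (\<lambda>(z, g, A) (z', g', A'). (\<forall>i<n. z' i = z i) \<and> insert (q n) A \<subseteq> A' \<and>
     (\<forall>k<n. \<forall>x \<in> A. g' k x = g k x \<and> (\<exists>y \<in> mspace U. g k y = x \<and> g' k y = x)))"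

text \<open>
  Let \<open>B\<close> consist of \<open>A\<close>, the points \<open>z i\<close>, and the images and inverse images of \<open>A\<close> under the
  \<open>g k\<close>, and let \<open>p\<close> be the next point of the copy, chosen relative to \<open>B\<close>.  Each \<open>g k\<close>, restricted to the relevant part of \<open>B\<close> and
  extended by \<open>p \<mapsto> p\<close>, is still isometric, and extends to the whole space by homogeneity.  The new
  isometry moves \<open>x\<^sub>0\<close> to a point \<open>w\<close> at distance 1 from \<open>B\<close> and \<open>p\<close>.
\<close>

lemma stage_step:
  assumes U: "urysohn_sphere U" and q: "\<And>i. q i \<in> mspace U" and s: "stage U q x\<^sub>0 n s"
  shows "\<exists>s'. stage U q x\<^sub>0 (Suc n) s' \<and> refines U q n s s'"
proof -
  interpret Metric_space "mspace U" "mdist U" by simp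
  let ?d = "mdist U"
  obtain z g A where s_eq: "s = (z, g, A)" by (cases s)
  have A: "finite A" "A \<subseteq> mspace U" "x\<^sub>0 \<in> A"
    and z: "\<And>i. i < n \<Longrightarrow> z i \<in> mspace U" "\<And>i. i < n \<Longrightarrow> ?d x\<^sub>0 (z i) = 1"
    and zq: "\<And>i j. i < n \<Longrightarrow> j < n \<Longrightarrow> ?d (z i) (z j) = ?d (q i) (q j)"
    and g: "\<And>k. k < n \<Longrightarrow> g k \<in> isometries U" "\<And>k i. k < n \<Longrightarrow> i < n \<Longrightarrow> g k (z i) = z i"
    and sep: "\<And>j k. j < n \<Longrightarrow> k < n \<Longrightarrow> j \<noteq> k \<Longrightarrow> ?d (g j x\<^sub>0) (g k x\<^sub>0) = 1"
    using s unfolding s_eq stage_def by auto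
  have x0: "x\<^sub>0 \<in> mspace U" using A by blast
  have gB: "g k \<in> Bij (mspace U)" if "k < n" for k using g(1)[OF that] by (simp add: isometries_def)
  have gd: "?d (g k x) (g k y) = ?d x y" if "k < n" "x \<in> mspace U" "y \<in> mspace U" for k x y
    using g(1)[OF that(1)] that by (simp add: isometries_def)
  define pre where "pre k = inv_into (mspace U) (g k)" for k
  have pre: "pre k x \<in> mspace U" "g k (pre k x) = x" if "k < n" "x \<in> mspace U" for k x
    unfolding pre_def using Bij_inv[OF gB[OF that(1)] that(2)] by auto
  define B where "B = A \<union> z ` {..<n} \<union> (\<Union>k<n. g k ` A \<union> pre k ` A)"
  have B: "finite B" "B \<subseteq> mspace U"
    using A z(1) gB pre(1) by (auto simp: B_def Bij_mem subset_iff)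
  have zB: "z i \<in> B" if "i < n" for i using that by (auto simp: B_def)
  obtain p where p: "p \<in> mspace U" "\<And>i. i < n \<Longrightarrow> ?d p (z i) = ?d (q n) (q i)"
    and p_cong: "\<And>x y. x \<in> B \<Longrightarrow> y \<in> B \<Longrightarrow> (\<And>i. i < n \<Longrightarrow> ?d (z i) x = ?d (z i) y) \<Longrightarrow> ?d p x = ?d p y"
    and p_1: "\<And>x. x \<in> B \<Longrightarrow> (\<And>i. i < n \<Longrightarrow> ?d (z i) x = 1) \<Longrightarrow> ?d p x = 1"
    by (rule urysohn_sphere_commonly_fixed_extension[where z = z and n = n and q = q, OF U B zB q zq]) (assumption | (erule that; blast))+
  have x0p: "?d x\<^sub>0 p = 1"
    using p_1[of x\<^sub>0] A(3) z(2) by (simp add: B_def commute)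
  have "\<exists>h \<in> isometries U. (\<forall>x \<in> A \<union> pre k ` A \<union> z ` {..<n}. h x = g k x) \<and> h p = p" if k: "k < n" for k
  proof -
    let ?C = "A \<union> pre k ` A \<union> z ` {..<n}"
    have CB: "?C \<subseteq> B" using k by (auto simp: B_def)
    have CU: "?C \<subseteq> mspace U" using CB B by blast
    have gC: "g k x \<in> B" if "x \<in> ?C" for x
      using that k pre(2)[OF k] A(2) g(2)[OF k] by (auto simp: B_def)
    have p_g: "?d p (g k x) = ?d p x" if x: "x \<in> ?C" for x
    proof (rule p_cong)
      show "?d (z i) (g k x) = ?d (z i) x" if "i < n" for i
        using gd[OF k z(1)[OF that], of x] g(2)[OF k that] x CU by auto
    qed (use x gC CB in auto)
    show ?thesis
    \<comment> \<open>If \<open>p\<close> is already in the domain, \<open>p_g\<close> shows that \<open>g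
        k\<close> fixes it.\<close>
    proof (cases "p \<in> ?C")
      case True
      then have "?d p (g k p) = 0" using p_g[OF True] p(1) by simp
      then have "g k p = p" using p(1) Bij_mem[OF gB[OF k] p(1)] by simp
      then show ?thesis using g(1)[OF k] by blast
    next
      case False
      obtain h where h: "h \<in> isometries U" "\<And>x. x \<in> insert p ?C \<Longrightarrow> h x = ((g k)(p := p)) x"
      proof (rule urysohn_sphere_homogeneous[OF U, of "insert p ?C" "(g k)(p := p)"])
        show "((g k)(p := p)) x \<in> mspace U" if "x \<in> insert p ?C" for x
          using that p(1) CU Bij_mem[OF gB[OF k]] by auto
        show "?d (((g k)(p := p)) x) (((g k)(p := p)) y) = ?d x y"
          if x: "x \<in> insert p ?C" and y: "y \<in> insert p ?C" for x y
        proof -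
          have "?d (g k x) p = ?d x p" if "x \<in> ?C" for x using p_g[OF that] by (simp add: commute)
          then show ?thesis using x y p_g CU gd[OF k] p(1) by (auto simp: subset_iff)
        qed
      qed (use A(1) CU p(1) in auto)
      then have "\<forall>x \<in> ?C. h x = g k x" "h p = p" using False by auto
      then show ?thesis using h(1) by blast
    qed
  qed
  then obtain h where h: "\<And>k. k < n \<Longrightarrow> h k \<in> isometries U"
    "\<And>k x. k < n \<Longrightarrow> x \<in> A \<union> pre k ` A \<union> z ` {..<n} \<Longrightarrow> h k x = g k x" "\<And>k. k < n \<Longrightarrow> h k p = p" by metis
  obtain w where w: "w \<in> mspace U" "\<And>b. b \<in> insert p B \<Longrightarrow> ?d w b = 1"
  proof (rule urysohn_sphere_one_point_extension[OF U, of "insert p B" "\<lambda>_. 1"])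
    show "?d a b \<le> 1 + 1" if "a \<in> insert p B" "b \<in> insert p B" for a b
      using urysohn_sphere_mdist_le_1[OF U, of a b] that p(1) B by force
  qed (use B p(1) in auto)
  let ?E = "insert p (z ` {..<n})"
  have x0E: "?d x\<^sub>0 b = 1" if "b \<in> ?E" for b using that z(2) x0p by auto
  have E: "finite ?E" "?E \<subseteq> mspace U" "?E \<subseteq> insert p B" using z(1) p(1) zB by auto
  have E0: "x\<^sub>0 \<notin> ?E" using x0E[of "x\<^sub>0"] x0 by (metis mdist_zero zero_neq_one)
  obtain e where e: "e \<in> isometries U" "\<And>x. x \<in> insert x\<^sub>0 ?E \<Longrightarrow> e x = (if x = x\<^sub>0 then w else x)"
  proof (rule urysohn_sphere_homogeneous[OF U, of "insert x\<^sub>0 ?E" "\<lambda>x. if x = x\<^sub>0 then w else x"])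
    show "(if x = x\<^sub>0 then w else x) \<in> mspace U" if "x \<in> insert x\<^sub>0 ?E" for x
      using that w(1) E(2) by auto
    show "?d (if x = x\<^sub>0 then w else x) (if y = x\<^sub>0 then w else y) = ?d x y"
      if "x \<in> insert x\<^sub>0 ?E" "y \<in> insert x\<^sub>0 ?E" for x y
    proof -
      have "?d w b = 1" if "b \<in> ?E" for b using w(2) E(3) that by blast
      then show ?thesis
        using that x0E w(1) x0 commute[of x w] commute[of x x\<^sub>0] by (cases "x = x\<^sub>0"; cases "y = x\<^sub>0") auto
    qed
  qed (use E x0 in auto)
  let ?s = "(z(n := p), h(n := e), insert (q n) A)"
  have h0: "h k x\<^sub>0 = g k x\<^sub>0" if "k < n" for k using h(2)[OF that] A(3) by blast
  have h0w: "?d w (h k x\<^sub>0) = 1" if "k < n" for k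
    using w(2)[of "g k x\<^sub>0"] A(3) that unfolding h0[OF that] by (auto simp: B_def)
  have e0: "e x\<^sub>0 = w" using e(2) by simp
  have eE: "e x = x" if "x \<in> ?E" for x using e(2)[of x] that E0 by auto
  have "stage U q x\<^sub>0 (Suc n) ?s"
    unfolding stage_def prod.case
  proof (intro conjI allI impI)
    show "finite (insert (q n) A)" "insert (q n) A \<subseteq> mspace U" "x\<^sub>0 \<in> insert (q n) A" using A q by auto
    fix i assume i: "i < Suc n"
    show "(z(n := p)) i \<in> mspace U" "?d x\<^sub>0 ((z(n := p)) i) = 1" using z p(1) x0p i by auto
    show "?d ((z(n := p)) i) ((z(n := p)) j) = ?d (q i) (q j)" if j: "j < Suc n" for j
      using i j zq p commute q by (auto simp: less_Suc_eq)
  next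
    fix k assume k: "k < Suc n"
    show "(h(n := e)) k \<in> isometries U" using k h(1) e(1) by auto
    show "(h(n := e)) k ((z(n := p)) i) = (z(n := p)) i" if i: "i < Suc n" for i
      using k i h(2)[of k "z i"] h(3)[of k] g(2)[of k i] eE by (auto simp: less_Suc_eq)
  next
    fix j k assume "j < Suc n" "k < Suc n" "j \<noteq> k"
    then show "?d ((h(n := e)) j x\<^sub>0) ((h(n := e)) k x\<^sub>0) = 1"
      using h0 sep h0w e0 by (auto simp: less_Suc_eq commute)
  qed
  moreover have "refines U q n s ?s"
    unfolding refines_def s_eq prod.case
  proof (intro conjI allI impI ballI)
    fix k x assume k: "k < n" and x: "x \<in> A"
    then show "(h(n := e)) k x = g k x" using h(2) by auto
    show "\<exists>y \<in> mspace U. g k y = x \<and> (h(n := e)) k y = x"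
      using pre[OF k, of x] h(2)[OF k, of "pre k x"] x A(2) k by (intro bexI[of _ "pre k x"]) auto
  qed auto
  ultimately show ?thesis by blast
qed

text \<open>
  For fixed \<open>k\<close>, each \<open>q n\<close> enters the set \<open>A\<close> at stage \<open>n + 1\<close>; from then on (and after stage \<open>k\<close>) the
  value and the inverse image of \<open>q n\<close> under the \<open>k\<close>-th isometry no longer change, so
  \<open>limit_isometry\<close> applies.
\<close>

lemma urysohn_sphere_fixed_dense_copy:
  fixes q :: "nat \<Rightarrow> 'u"
  assumes U: "urysohn_sphere U" and dense: "dense_sequence U q" and x0: "x\<^sub>0 \<in> mspace U"
  shows "\<exists>(z :: nat \<Rightarrow> 'u) (f :: nat \<Rightarrow> 'u \<Rightarrow> 'u).
    (\<forall>n. z n \<in> mspace U) \<and> (\<forall>i j. mdist U (z i) (z j) = mdist U (q i) (q j)) \<and>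
    (\<forall>k. f k \<in> isometries U) \<and> (\<forall>k n. f k (z n) = z n) \<and>
    (\<forall>j k. j \<noteq> k \<longrightarrow> mdist U (f j x\<^sub>0) (f k x\<^sub>0) = 1)"
proof -
  have q: "\<And>n. q n \<in> mspace U" using dense by (simp add: dense_sequence_def)
  \<comment> \<open>Stage 0 leaves the first two components arbitrary.\<close>
  have "stage U q x\<^sub>0 0 (q, \<lambda>_. id, {x\<^sub>0})" using x0 by (simp add: stage_def)
  then have start: "\<exists>s. stage U q x\<^sub>0 0 s" by blast
  have "\<exists>s. \<forall>n. stage U q x\<^sub>0 n (s n) \<and> refines U q n (s n) (s (Suc n))"
    by (rule dependent_nat_choice[of "stage U q x\<^sub>0" "refines U q", OF start stage_step[OF U q]])
  then obtain s where s: "\<And>n. stage U q x\<^sub>0 n (s n)" "\<And>n. refines U q n (s n) (s (Suc n))" by blast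
  define zs where "zs n = fst (s n)" for n
  define gs where "gs n = fst (snd (s n))" for n
  define A where "A n = snd (snd (s n))" for n
  have s_eq: "s n = (zs n, gs n, A n)" for n by (simp add: zs_def gs_def A_def)
  note st = s(1)[unfolded s_eq stage_def prod.case] and re = s(2)[unfolded s_eq refines_def prod.case]
  have A: "A n \<subseteq> mspace U" "x\<^sub>0 \<in> A n" for n using st[of n] by simp_all
  have A_Suc: "insert (q n) (A n) \<subseteq> A (Suc n)" for n using re[of n] by simp
  have A_mono: "A m \<subseteq> A n" if "m \<le> n" for m n
  proof (rule lift_Suc_mono_le[of A, OF _ that])
    show "A i \<subseteq> A (Suc i)" for i using A_Suc[of i] by simp
  qed
  have qA: "q n \<in> A m" if "n < m" for n m using A_Suc[of n] A_mono[of "Suc n" m] that by auto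
  have zs_Suc: "zs (Suc n) i = zs n i" if "i < n" for n i using re[of n] that by simp
  have zs: "zs n i = zs (Suc i) i" if "i < n" for n i
    using Suc_leI[OF that] by (induction n rule: dec_induct) (auto simp: zs_Suc)
  have gs: "gs n k \<in> isometries U" if "k < n" for n k using st[of n] that by simp
  have gs_Suc: "gs (Suc n) k x = gs n k x" "\<exists>y \<in> mspace U. gs n k y = x \<and> gs (Suc n) k y = x"
    if "k < n" "x \<in> A n" for n k x using re[of n] that by simp_all
  have gs_stable: "gs m k x = gs n k x" if "k < n" "n \<le> m" "x \<in> A n" for n m k x
    using that(2)
  proof (induction m rule: dec_induct)
    case (step m)
    then show ?case using gs_Suc(1)[of k m x] that A_mono[of n m] by auto
  qed simp
  have gs_inj: "y = y'" if "k < n" "y \<in> mspace U" "y' \<in> mspace U" "gs n k y = gs n k y'" for n k y y'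
    using gs[OF that(1)] that by (auto simp: isometries_def Bij_def bij_betw_def dest: inj_onD)
  have gs_preimage: "gs m k y = x"
    if k: "k < n" and m: "n \<le> m" and x: "x \<in> A n" and y: "y \<in> mspace U" "gs n k y = x" for n m k x y
    using m
  proof (induction m rule: dec_induct)
    case (step m)
    have "x \<in> A m" "k < m" using k x A_mono[of n m] step.hyps by auto
    then obtain y' where "y' \<in> mspace U" "gs m k y' = x" "gs (Suc m) k y' = x"
      using gs_Suc(2) by blast
    then show ?case using gs_inj[OF \<open>k < m\<close> y(1), of y'] step.IH by simp
  qed (rule y(2))
  define z where "z i = zs (Suc i) i" for i
  have z: "z i \<in> mspace U" for i using st[of "Suc i"] by (simp add: z_def)
  have zq: "mdist U (z i) (z j) = mdist U (q i) (q j)" for i j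
  proof -
    have "mdist U (zs (Suc (max i j)) i) (zs (Suc (max i j)) j) = mdist U (q i) (q j)"
      using st[of "Suc (max i j)"] by simp
    then show ?thesis using zs[of i "Suc (max i j)"] zs[of j "Suc (max i j)"] by (simp add: z_def)
  qed
  have complete: "mcomplete_of U" using U by (simp add: urysohn_sphere_def)
  have "\<exists>f \<in> isometries U. f x\<^sub>0 = gs (Suc k) k x\<^sub>0 \<and> (\<forall>n. f (z n) = z n)" for k
  proof -
    \<comment> \<open>The \<open>k\<close>-th isometry is introduced at stage \<open>k + 1\<close>.\<close>
    define h where "h m = gs (m + Suc k) k" for m
    have hU: "h m \<in> isometries U" for m unfolding h_def by (rule gs) simp
    have ev: "\<exists>v N. \<forall>m\<ge>N. h m (q n) = v" for n
    proof (intro exI allI impI)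
      fix m assume "Suc n \<le> m"
      then show "h m (q n) = h (Suc n) (q n)"
        unfolding h_def by (intro gs_stable qA) auto
    qed
    have pre: "\<exists>y \<in> mspace U. \<exists>N. \<forall>m\<ge>N. h m y = q n" for n
    proof -
      have B: "h (Suc n) \<in> Bij (mspace U)" using hU by (simp add: isometries_def)
      obtain y where y: "y \<in> mspace U" "h (Suc n) y = q n" using Bij_inv(1,2)[OF B q[of n]] by blast
      have "h m y = q n" if m: "Suc n \<le> m" for m
        unfolding h_def
      proof (rule gs_preimage[of k "Suc n + Suc k" "m + Suc k" "q n" y])
        show "q n \<in> A (Suc n + Suc k)" by (rule qA) simp
        show "gs (Suc n + Suc k) k y = q n" using y(2) by (simp only: h_def)
      qed (use m y(1) in simp_all)
      then show ?thesis using y(1) by (intro bexI[of _ y] exI[of _ "Suc n"]) auto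
    qed
    obtain f where f: "f \<in> isometries U"
      "\<And>u v N. u \<in> mspace U \<Longrightarrow> \<forall>m\<ge>N. h m u = v \<Longrightarrow> f u = v"
      by (rule limit_isometry[where U = U and q = q and h = h, OF complete dense hU ev pre]) (assumption | (erule that; blast))+
    have "f x\<^sub>0 = gs (Suc k) k x\<^sub>0"
      by (rule f(2)[OF x0, of 0]) (auto simp: h_def intro!: gs_stable A)
    moreover have "f (z n) = z n" for n
    proof (rule f(2)[OF z, of "Suc n"], intro allI impI)
      fix m assume m: "Suc n \<le> m"
      then have "gs (m + Suc k) k (zs (m + Suc k) n) = zs (m + Suc k) n"
        using st[of "m + Suc k"] by simp
      then show "h m (z n) = z n" using zs[of n "m + Suc k"] m by (simp add: h_def z_def)
    qed
    ultimately show ?thesis using f(1) by blast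
  qed
  then obtain f where f: "\<And>k. f k \<in> isometries U" "\<And>k. f k x\<^sub>0 = gs (Suc k) k x\<^sub>0" "\<And>k n. f k (z n) = z n"
    by metis
  have "mdist U (f j x\<^sub>0) (f k x\<^sub>0) = 1" if "j \<noteq> k" for j k
  proof -
    let ?n = "Suc (max j k)"
    have "mdist U (gs ?n j x\<^sub>0) (gs ?n k x\<^sub>0) = 1" using st[of ?n] that by simp
    moreover have "gs ?n j x\<^sub>0 = f j x\<^sub>0" "gs ?n k x\<^sub>0 = f k x\<^sub>0"
      unfolding f(2) by (rule gs_stable; use A(2) in simp)+
    ultimately show ?thesis by simp
  qed
  then show ?thesis using z zq f(1,3) by (intro exI[of _ z] exI[of _ f] conjI allI impI) auto
qed

lemma urysohn_sphere_dense_sequence: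
  fixes U :: "'a metric"
  assumes U: "urysohn_sphere U"
  obtains q where "dense_sequence U q"
proof -
  interpret Metric_space "mspace U" "mdist U" by simp
  obtain p where "p \<in> mspace U"
    using urysohn_sphere_one_point_extension[OF U, of "{}" "\<lambda>_. 0"] by auto
  obtain C where C: "countable C" "C \<subseteq> mspace U" "mtopology closure_of C = mspace U"
    using U by (auto simp: urysohn_sphere_def separable_space_def mtopology_of_def)
  have "C \<noteq> {}" using C(3) \<open>p \<in> mspace U\<close> by auto
  then have ran: "range (from_nat_into C) = C" using C(1) by (rule range_from_nat_into)
  show ?thesis
  proof (rule that[of "from_nat_into C"], unfold dense_sequence_def, intro conjI allI ballI impI)
    show "from_nat_into C n \<in> mspace U" for n using ran C(2) by blast
    fix x and e :: real assume "x \<in> mspace U" "e > 0"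
    then obtain y where "y \<in> C" "mdist U x y < e"
      using C(3) metric_closure_of[of C] by fastforce
    then show "\<exists>n. mdist U (from_nat_into C n) x < e" using ran by (metis commute imageE)
  qed
qed

text \<open>
  Here \<open>\<zeta>\<close> is the isometric embedding that extends \<open>q n \<mapsto> z n\<close>.  Its restriction to a finite set
  extends to an isometry by homogeneity, and an isometry fixing all \<open>z n\<close> fixes the range of \<open>\<zeta>\<close>.
\<close>

lemma urysohn_sphere_stabilized_limit:
  fixes U :: "'u metric"
  assumes U: "urysohn_sphere U"
  shows "\<exists>(I :: ('u set \<times> real) set) N D.
    noncompactly_stabilized_limit (isometry_group U) (isometry_topology U) I N D"
proof -
  obtain q where dense: "dense_sequence U q" using urysohn_sphere_dense_sequence[OF U] .
  have q: "\<And>n. q n \<in> mspace U" using dense by (simp add: dense_sequence_def)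
  have complete: "mcomplete_of U" using U by (simp add: urysohn_sphere_def)
  obtain z and f :: "nat \<Rightarrow> 'u \<Rightarrow> 'u" where zf: "\<forall>n. z n \<in> mspace U" "\<forall>i j. mdist U (z i) (z j) = mdist U (q i) (q j)"
    "\<forall>k. f k \<in> isometries U" "\<forall>k n. f k (z n) = z n"
    "\<forall>j k. j \<noteq> k \<longrightarrow> mdist U (f j (q 0)) (f k (q 0)) = 1"
    using urysohn_sphere_fixed_dense_copy[where U = U and q = q, OF U dense q[of 0]] by (elim exE conjE)
  note z = zf(1,2)[rule_format] and f = zf(3,4)[rule_format] and sep = zf(5)[rule_format]
  obtain \<zeta> where \<zeta>: "\<zeta> \<in> mspace U \<rightarrow> mspace U" "\<And>n. \<zeta> (q n) = z n"
    "\<And>x y. x \<in> mspace U \<Longrightarrow> y \<in> mspace U \<Longrightarrow> mdist U (\<zeta> x) (\<zeta> y) = mdist U x y"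
    by (rule dense_copy_extends[where U = U and q = q and w = z, OF complete dense z]) (erule that; simp)
  have "noncompactly_stabilized_limit (perm_group (mspace U) (isometries U))
    (pointwise_topology (mtopology_of U) (isometries U))
    {(A, e). finite A \<and> A \<subseteq> mspace U \<and> e > 0}
    (\<lambda>(A, e). {h \<in> isometries U. \<forall>x \<in> A. mdist U (h x) (\<zeta> x) < e}) (range f)"
  proof (rule noncompactly_stabilized_limit_pointwise[OF _ subset_refl \<zeta>(1)])
    show "group (perm_group (mspace U) (isometries U))"
      using group_isometry_group[of U] by (simp add: isometry_group_def)
    show "\<exists>h \<in> isometries U. \<forall>x \<in> A. mdist U (h x) (\<zeta> x) < e"
      if A: "finite A" "A \<subseteq> mspace U" and e: "e > 0" for A e
    proof -
      obtain h where h: "h \<in> isometries U" "\<And>x. x \<in> A \<Longrightarrow> h x = \<zeta> x"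
        by (rule urysohn_sphere_homogeneous[OF U A, of \<zeta>]) (use \<zeta>(1,3) A(2) in \<open>auto simp: subset_iff Pi_iff\<close>)
      moreover have "mdist U (\<zeta> x) (\<zeta> x) = 0" if "x \<in> A" for x
        using \<zeta>(1) A(2) that by (auto simp: Pi_iff)
      ultimately show ?thesis using e by (intro bexI[of _ h]) auto
    qed
    show "f k \<in> isometries U" for k by (rule f(1))
    show "f k (\<zeta> x) = \<zeta> x" if x: "x \<in> mspace U" for k x
    proof (rule isometries_agreeing_on_dense[where U = U and q = q and f = "\<lambda>x. f k (\<zeta> x)" and g = \<zeta>,
          OF complete dense _ _ \<zeta>(1,3) _ x])
      have fB: "f k \<in> Bij (mspace U)" and fd: "\<And>x y. x \<in> mspace U \<Longrightarrow> y \<in> mspace U \<Longrightarrow> mdist U (f k x) (f k y) = mdist U x y"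
        using f(1)[of k] by (auto simp: isometries_def)
      show "(\<lambda>x. f k (\<zeta> x)) \<in> mspace U \<rightarrow> mspace U" using Bij_mem[OF fB] \<zeta>(1) by blast
      show "mdist U (f k (\<zeta> x)) (f k (\<zeta> y)) = mdist U x y" if "x \<in> mspace U" "y \<in> mspace U" for x y
        using fd \<zeta>(1,3) that by (simp add: Pi_iff)
      show "f k (\<zeta> (q n)) = \<zeta> (q n)" for n by (simp add: \<zeta>(2) f(2))
    qed
    show "q 0 \<in> mspace U" by (rule q)
    show "0 < (1::real)" by simp
    show "1 \<le> mdist U (f j (q 0)) (f k (q 0))" if "j \<noteq> k" for j k using sep[OF that] by simp
  qed
  then show ?thesis unfolding isometry_group_def isometry_topology_def by blast
qed

section \<open>Homeomorphisms of the unit interval\<close>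

lemma homeo_plus_I:
  fixes f :: "real \<Rightarrow> real"
  assumes cont: "continuous_on {0..1} f" and mono: "strict_mono_on {0..1} f" and "f 0 = 0" "f 1 = 1"
  shows "restrict f {0..1} \<in> homeo_plus"
proof -
  let ?I = "{0..1::real}"
  have le: "f x \<le> f y" if "x \<in> ?I" "y \<in> ?I" "x \<le> y" for x y
    using mono that by (cases "x = y") (auto simp: strict_mono_on_def less_le)
  have "f ` ?I \<subseteq> ?I"
    using le[of 0] le[of _ 1] assms(3,4) by auto
  moreover have "?I \<subseteq> f ` ?I"
  proof
    fix y assume "y \<in> ?I"
    then show "y \<in> f ` ?I" using IVT'[of f 0 y 1] cont assms(3,4) by auto
  qed
  ultimately have img: "f ` ?I = ?I" by blast
  have inj: "inj_on f ?I" using mono by (rule strict_mono_on_imp_inj_on)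
  have "homeomorphic_map (top_of_set ?I) (top_of_set ?I) f"
    by (rule continuous_imp_homeomorphic_map)
      (use cont img inj in \<open>auto simp: compact_space_subtopology Hausdorff_space_subtopology\<close>)
  then have "homeomorphic_map (top_of_set ?I) (top_of_set ?I) (restrict f ?I)"
    by (rule homeomorphic_map_eq) auto
  moreover have "restrict f ?I \<in> Bij ?I"
    using inj img by (auto simp: Bij_def bij_betw_def inj_on_def)
  ultimately show ?thesis using assms(3,4) by (simp add: homeo_plus_def)
qed

lemma topspace_homeo_plus_topology: "topspace homeo_plus_topology = homeo_plus"
proof -
  have "{f \<in> homeo_plus. f ` {} \<subseteq> {}} \<in>
      {{f \<in> homeo_plus. f ` K \<subseteq> U} | K U. compactin (top_of_set {0..1}) K \<and> openin (top_of_set {0..1}) U}"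
    by blast
  then show ?thesis by (auto simp: homeo_plus_topology_def compact_open_topology_def)
qed

lemma openin_homeo_plus_topology:
  assumes "compact K" "K \<subseteq> {0..1}" "open W"
  shows "openin homeo_plus_topology {f \<in> homeo_plus. f ` K \<subseteq> {0..1} \<inter> W}"
proof -
  have "compactin (top_of_set {0..1}) K" using assms by (simp add: compactin_subtopology)
  moreover have "openin (top_of_set {0..1}) ({0..1} \<inter> W)" using assms(3) by (rule openin_open_Int)
  ultimately show ?thesis
    unfolding homeo_plus_topology_def compact_open_topology_def
    by (intro topology_generated_by_Basis) blast
qed

lemma homeo_plus_maps: "f \<in> homeo_plus \<Longrightarrow> x \<in> {0..1} \<Longrightarrow> f x \<in> {0..1}"
  using Bij_mem[of f "{0..1}" x] by (simp add: homeo_plus_def)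

text \<open>
  This and the next lemma identify the neighbourhoods of the identity in the compact-open topology
  with those of uniform convergence.  Here it suffices to treat a subbasic set, where a compact \<open>K\<close> has
  positive distance from the complement of the open set around it.
\<close>

lemma homeo_plus_nbhd_contains_uniform_ball:
  assumes "openin homeo_plus_topology V" "(\<lambda>x\<in>{0..1}. x) \<in> V"
  shows "\<exists>e>0. \<forall>f \<in> homeo_plus. (\<forall>x \<in> {0..1}. \<bar>f x - x\<bar> < e) \<longrightarrow> f \<in> V"
proof -
  have "generate_topology_on {{f \<in> homeo_plus. f ` K \<subseteq> U} | K U.
      compactin (top_of_set {0..1}) K \<and> openin (top_of_set {0..1}) U} V"
    using assms(1) unfolding homeo_plus_topology_def compact_open_topology_def
    by (rule openin_topology_generated_by)
  then show ?thesis using assms(2)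
  proof (induction rule: generate_topology_on.induct)
    case Empty
    then show ?case by simp
  next
    case (Int V W)
    then obtain d e where "d > 0" "e > 0"
      "\<forall>f \<in> homeo_plus. (\<forall>x \<in> {0..1}. \<bar>f x - x\<bar> < d) \<longrightarrow> f \<in> V"
      "\<forall>f \<in> homeo_plus. (\<forall>x \<in> {0..1}. \<bar>f x - x\<bar> < e) \<longrightarrow> f \<in> W" by auto
    then show ?case by (intro exI[of _ "min d e"]) auto
  next
    case (UN \<V>)
    then obtain V where "V \<in> \<V>" "(\<lambda>x\<in>{0..1}. x) \<in> V" by blast
    then show ?case using UN.IH[of V] by blast
  next
    case (Basis V)
    then obtain K U where V: "V = {f \<in> homeo_plus. f ` K \<subseteq> U}"
      and K: "compactin (top_of_set {0..1}) K" and U: "openin (top_of_set {0..1::real}) U" by blast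
    have K': "compact K" "K \<subseteq> {0..1}" using K by (auto simp: compactin_subtopology)
    obtain W where W: "open W" "U = {0..1} \<inter> W" using U by (auto simp: openin_open)
    have "(\<lambda>x\<in>{0..1}. x) ` K = K" using K'(2) by (force simp: image_iff)
    then have "K \<subseteq> W" using Basis.prems W by (auto simp: V)
    then obtain e where e: "e > 0" "(\<Union>x\<in>K. ball x e) \<subseteq> W"
      using compact_subset_open_imp_ball_epsilon_subset[OF K'(1) W(1)] by blast
    have "f \<in> V" if f: "f \<in> homeo_plus" "\<forall>x \<in> {0..1}. \<bar>f x - x\<bar> < e" for f
    proof -
      have "f x \<in> U" if "x \<in> K" for x
      proof -
        have "x \<in> {0..1}" using that K' by blast
        then have "f x \<in> ball x e" using f(2) by (auto simp: dist_real_def abs_minus_commute)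
        then show ?thesis using e(2) that W(2) homeo_plus_maps[OF f(1) \<open>x \<in> {0..1}\<close>] by blast
      qed
      then show ?thesis using f(1) by (auto simp: V)
    qed
    then show ?case using e(1) by blast
  qed
qed

text \<open>
  Cut the interval into \<open>m\<close> pieces \<open>K i\<close> of length \<open>1 / m\<close> with \<open>2 / m < e\<close>.  If \<open>f\<close> sends each \<open>K i\<close>
  into the open interval \<open>W i\<close> obtained by adding one length on either side, then no point moves by
  \<open>2 / m\<close> or more.
\<close>

lemma uniform_ball_contains_homeo_plus_nbhd:
  assumes e: "e > 0"
  shows "\<exists>V. openin homeo_plus_topology V \<and> (\<lambda>x\<in>{0..1}. x) \<in> V \<and>
    (\<forall>f \<in> V. \<forall>x \<in> {0..1}. \<bar>f x - x\<bar> < e)"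
proof -
  obtain n where n: "inverse (real (Suc n)) < e / 2" using reals_Archimedean[of "e/2"] e by auto
  define m where "m = Suc n"
  have m: "m > 0" "2 / real m < e" using n by (auto simp: m_def field_simps)
  define K where "K i = {real i / m .. (real i + 1) / m}" for i
  define W where "W i = {(real i - 1) / m <..< (real i + 2) / m}" for i
  have K: "compact (K i)" "K i \<subseteq> {0..1}" if "i < m" for i
    using that m by (auto simp: K_def field_simps)
  let ?V = "\<Inter>i<m. {f \<in> homeo_plus. f ` K i \<subseteq> {0..1} \<inter> W i}"
  have "openin homeo_plus_topology ?V"
    using m K by (intro openin_INT2 openin_homeo_plus_topology) (auto simp: W_def)
  moreover have "(\<lambda>x\<in>{0..1}. x) \<in> ?V"
  proof -
    have "x \<in> W i" if "x \<in> K i" for x i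
    proof -
      have "(real i - 1) / m < real i / m" "(real i + 1) / m < (real i + 2) / m"
        using m by (auto simp: divide_strict_right_mono)
      then show ?thesis using that by (auto simp: K_def W_def)
    qed
    moreover have "(\<lambda>x\<in>{0..1}. x) \<in> homeo_plus"
      by (rule homeo_plus_I) (auto simp: strict_mono_on_def)
    ultimately show ?thesis using K(2) by (auto simp: subset_iff)
  qed
  moreover have "\<bar>f x - x\<bar> < e" if f: "f \<in> ?V" and x: "x \<in> {0..1}" for f x
  proof -
    obtain i where i: "i < m" "x \<in> K i"
    proof (cases "x = 1")
      case True
      then show ?thesis using that[of n] by (simp add: m_def K_def)
    next
      case False
      define i where "i = nat \<lfloor>x * m\<rfloor>"
      have i: "real i \<le> x * m" "x * m < real i + 1" using x by (auto simp: i_def)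
      have "x * m < m" using False x m by simp
      then have "i < m" using i(1) by linarith
      moreover have "x \<in> K i" using i m by (auto simp: K_def field_simps)
      ultimately show ?thesis using that by blast
    qed
    then have "f x \<in> W i" using f by blast
    then have "f x < (real i + 2) / m" "(real i - 1) / m < f x"
      "real i / m \<le> x" "x \<le> (real i + 1) / m" using i(2) by (auto simp: W_def K_def)
    then have "f x - x < 2 / m" "x - f x < 2 / m"
      by (auto simp: add_divide_distrib diff_divide_distrib)
    then show ?thesis using m(2) by linarith
  qed
  ultimately show ?thesis by (intro exI[of _ ?V] conjI ballI)
qed

definition half_collapse :: "real \<Rightarrow> real" where
  "half_collapse x = max 0 (2 * x - 1)"

text \<open>
  The map \<open>x \<mapsto> x (2 x)\<^sup>m\<close> on \<open>[0, 1/2]\<close>, continued by the identity.  For large \<open>m\<close> it pushes points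
  below \<open>1/2\<close> towards \<open>0\<close>.
\<close>

definition half_squeeze :: "nat \<Rightarrow> real \<Rightarrow> real" where
  "half_squeeze m = (\<lambda>x \<in> {0..1}. x * min (2 * x) 1 ^ m)"

lemma half_squeeze_homeo_plus: "half_squeeze m \<in> homeo_plus"
  unfolding half_squeeze_def
proof (rule homeo_plus_I)
  show "continuous_on {0..1} (\<lambda>x::real. x * min (2 * x) 1 ^ m)" by (intro continuous_intros)
  show "strict_mono_on {0..1} (\<lambda>x::real. x * min (2 * x) 1 ^ m)"
  proof (rule strict_mono_onI)
    fix x y :: real assume xy: "x \<in> {0..1}" "y \<in> {0..1}" "x < y"
    have "x * min (2 * x) 1 ^ m \<le> x * min (2 * y) 1 ^ m"
      using xy by (intro mult_left_mono power_mono) auto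
    also have "\<dots> < y * min (2 * y) 1 ^ m"
      using xy by (intro mult_strict_right_mono) auto
    finally show "x * min (2 * x) 1 ^ m < y * min (2 * y) 1 ^ m" .
  qed
qed auto

lemma half_collapse_half_squeeze:
  assumes "x \<in> {0..1}"
  shows "half_collapse (half_squeeze m x) = half_collapse x"
proof (cases "x \<le> 1/2")
  case True
  then have "(2 * x) ^ m \<le> 1" using assms by (intro power_le_one) auto
  then have "x * (2 * x) ^ m \<le> 1/2 * 1" using True assms by (intro mult_mono) auto
  then show ?thesis using True assms by (simp add: half_collapse_def half_squeeze_def min_def)
next
  case False
  then show ?thesis using assms by (simp add: half_collapse_def half_squeeze_def min_def)
qed

text \<open>
  A convex combination of \<open>half_collapse\<close> with a little of the identity is strictly increasing.
\<close>

lemma half_collapse_approx: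
  assumes e: "e > 0"
  shows "\<exists>f \<in> homeo_plus. \<forall>x \<in> {0..1}. \<bar>f x - half_collapse x\<bar> < e"
proof -
  define t where "t = min (e / 2) (1/2)"
  have t: "0 < t" "t < 1" "t < e" using e by (auto simp: t_def)
  define f where "f x = (1 - t) * half_collapse x + t * x" for x
  have "restrict f {0..1} \<in> homeo_plus"
  proof (rule homeo_plus_I)
    show "continuous_on {0..1} f" unfolding f_def half_collapse_def by (intro continuous_intros)
    show "strict_mono_on {0..1} f"
    proof (rule strict_mono_onI)
      fix x y :: real assume "x < y"
      then have "(1 - t) * half_collapse x \<le> (1 - t) * half_collapse y" "t * x < t * y"
        using t by (auto intro!: mult_left_mono simp: half_collapse_def)
      then show "f x < f y" by (simp add: f_def)
    qed
  qed (auto simp: f_def half_collapse_def)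
  moreover have "\<bar>f x - half_collapse x\<bar> < e" if x: "x \<in> {0..1}" for x
  proof -
    have "f x - half_collapse x = t * (x - half_collapse x)" by (simp add: f_def algebra_simps)
    moreover have "\<bar>x - half_collapse x\<bar> \<le> 1" using x by (auto simp: half_collapse_def)
    ultimately have "\<bar>f x - half_collapse x\<bar> \<le> t * 1"
      using t(1) by (simp add: abs_mult mult_left_le)
    then show ?thesis using t(3) by simp
  qed
  ultimately show ?thesis by (intro bexI[of _ "restrict f {0..1}"]) auto
qed

text \<open>
  On a compact set of homeomorphisms the value at \<open>1/4\<close> attains a minimum, which is positive; but the
  maps \<open>half_squeeze m\<close> take values tending to \<open>0\<close> there.
\<close>

lemma half_squeezes_not_in_compact:
  assumes K: "compactin homeo_plus_topology K"
  shows "\<not> range half_squeeze \<subseteq> K"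
proof
  assume sub: "range half_squeeze \<subseteq> K"
  have "continuous_map homeo_plus_topology euclideanreal (\<lambda>f. f (1/4))"
    unfolding continuous_map_def
  proof (intro conjI allI impI)
    fix W :: "real set" assume "openin euclidean W"
    then have "openin homeo_plus_topology {f \<in> homeo_plus. f ` {1/4} \<subseteq> {0..1} \<inter> W}"
      by (intro openin_homeo_plus_topology) auto
    moreover have "{f \<in> homeo_plus. f ` {1/4} \<subseteq> {0..1} \<inter> W} = {f \<in> homeo_plus. f (1/4) \<in> W}"
      using homeo_plus_maps[of _ "1/4"] by auto
    ultimately show "openin homeo_plus_topology {f \<in> topspace homeo_plus_topology. f (1/4) \<in> W}"
      by (simp add: topspace_homeo_plus_topology)
  qed auto
  then have "compact ((\<lambda>f. f (1/4)) ` K)"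
    using image_compactin[OF K] by (simp flip: compactin_euclidean_iff)
  moreover have "(\<lambda>f. f (1/4)) ` K \<noteq> {}" using sub by blast
  ultimately obtain f where f: "f \<in> K" "\<And>h. h \<in> K \<Longrightarrow> f (1/4) \<le> h (1/4)"
    using compact_attains_inf[of "(\<lambda>f. f (1/4)) ` K"] by auto
  have "f \<in> homeo_plus"
    using f(1) compactin_subset_topspace[OF K] by (auto simp: topspace_homeo_plus_topology)
  then have "inj_on f {0..1}" "f 0 = 0" "f (1/4) \<in> {0..1}"
    using homeo_plus_maps[of f "1/4"] by (auto simp: homeo_plus_def Bij_def bij_betw_def)
  then have "f (1/4) > 0"
    using inj_onD[of f "{0..1}" "1/4" 0] by (auto simp: less_le)
  then obtain m where "(1/2) ^ m < f (1/4)"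
    using real_arch_pow_inv[of "f (1/4)" "1/2"] by auto
  moreover have "f (1/4) \<le> half_squeeze m (1/4)" using f(2) sub by blast
  moreover have "half_squeeze m (1/4) \<le> (1/2) ^ m"
    by (simp add: half_squeeze_def min_def)
  ultimately show False by linarith
qed

text \<open>
  The filter base consists of the homeomorphisms whose inverses are uniformly close to
  \<open>half_collapse\<close>.  It is preserved by \<open>half_squeeze m\<close> since
  \<open>(g h)\<^sup>-\<^sup>1 = h\<^sup>-\<^sup>1 \<circ> g\<^sup>-\<^sup>1\<close> and \<open>half_collapse \<circ> g\<^sup>-\<^sup>1 = half_collapse\<close> for \<open>g = half_squeeze m\<close>.
\<close>

lemma homeo_plus_stabilized_limit:
  "\<exists>(I :: real set) N D. noncompactly_stabilized_limit homeo_plus_group homeo_plus_topology I N D"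
proof -
  let ?T = homeo_plus_topology
  define G where "G = homeo_plus_group"
  have G: "G = perm_group {0..1} homeo_plus" by (simp add: G_def homeo_plus_group_def)
  have grp: "group G" unfolding G_def by (rule group_homeo_plus_group)
  interpret group G by (rule grp)
  have Bij: "homeo_plus \<subseteq> Bij {0..1}" by (auto simp: homeo_plus_def)
  note carrier = perm_group_carrier[OF grp G Bij]
    and mult = perm_group_mult_apply[OF grp G Bij]
    and one = perm_group_one[OF grp G Bij]
    and inv_apply = perm_group_inv_apply[OF grp G Bij]
  have inv_mem: "inv\<^bsub>G\<^esub> f \<in> homeo_plus" if "f \<in> homeo_plus" for f
    using inv_closed that by (simp add: carrier)
  have mult_mem: "f \<otimes>\<^bsub>G\<^esub> g \<in> homeo_plus" if "f \<in> homeo_plus" "g \<in> homeo_plus" for f g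
    using m_closed that by (simp add: carrier)
  let ?N = "\<lambda>e. {h \<in> homeo_plus. \<forall>x \<in> {0..1}. \<bar>(inv\<^bsub>G\<^esub> h) x - half_collapse x\<bar> < e}"
  have "noncompactly_stabilized_limit G ?T {0<..} ?N (range half_squeeze)"
  proof (intro noncompactly_stabilized_limit.intro noncompactly_stabilized_limit_axioms.intro)
    show "group G" by (rule grp)
    show "topspace ?T = carrier G" by (simp add: topspace_homeo_plus_topology carrier)
    show "?N e \<subseteq> carrier G" for e by (auto simp: carrier)
    show "?N e \<noteq> {}" if e: "e \<in> {0<..}" for e
    proof -
      obtain f where f: "f \<in> homeo_plus" "\<forall>x \<in> {0..1}. \<bar>f x - half_collapse x\<bar> < e"
        using half_collapse_approx[of e] e unfolding greaterThan_iff by blast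
      then have "inv\<^bsub>G\<^esub> f \<in> ?N e" using inv_mem[OF f(1)] by (simp add: carrier)
      then show ?thesis by blast
    qed
    show "{0<..} \<noteq> ({} :: real set)" using greaterThan_non_empty by blast
    show "\<exists>k \<in> {0<..}. ?N k \<subseteq> ?N i \<inter> ?N j" if "i \<in> {0<..}" "j \<in> {0<..}" for i j
      using that by (intro bexI[of _ "min i j"]) auto
    show "\<exists>i \<in> {0<..}. \<forall>a \<in> ?N i. \<forall>b \<in> ?N i. inv\<^bsub>G\<^esub> a \<otimes>\<^bsub>G\<^esub> b \<in> V"
      if V: "openin ?T V" "\<one>\<^bsub>G\<^esub> \<in> V" for V
    proof -
      obtain e where e: "e > 0" "\<forall>f \<in> homeo_plus. (\<forall>x \<in> {0..1}. \<bar>f x - x\<bar> < e) \<longrightarrow> f \<in> V"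
        using homeo_plus_nbhd_contains_uniform_ball[OF V(1)] V(2) unfolding one by blast
      show ?thesis
      proof (intro bexI[of _ "e/2"] ballI)
        fix a b assume a: "a \<in> ?N (e/2)" and b: "b \<in> ?N (e/2)"
        show "inv\<^bsub>G\<^esub> a \<otimes>\<^bsub>G\<^esub> b \<in> V"
        proof (rule e(2)[rule_format])
          show "inv\<^bsub>G\<^esub> a \<otimes>\<^bsub>G\<^esub> b \<in> homeo_plus" using a b inv_mem mult_mem by auto
          fix x :: real assume x: "x \<in> {0..1}"
          have bx: "b x \<in> {0..1}" using b x homeo_plus_maps by auto
          have "(inv\<^bsub>G\<^esub> a \<otimes>\<^bsub>G\<^esub> b) x = (inv\<^bsub>G\<^esub> a) (b x)" "(inv\<^bsub>G\<^esub> b) (b x) = x"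
            using a b x inv_mem by (auto simp: mult inv_apply)
          moreover have "\<bar>(inv\<^bsub>G\<^esub> a) (b x) - half_collapse (b x)\<bar> < e/2"
            "\<bar>(inv\<^bsub>G\<^esub> b) (b x) - half_collapse (b x)\<bar> < e/2" using a b bx by blast+
          ultimately show "\<bar>(inv\<^bsub>G\<^esub> a \<otimes>\<^bsub>G\<^esub> b) x - x\<bar> < e" by linarith
        qed
      qed (use e in auto)
    qed
    show "\<exists>j \<in> {0<..}. \<exists>V. openin ?T V \<and> \<one>\<^bsub>G\<^esub> \<in> V \<and>
        (\<forall>a \<in> ?N j. \<forall>b \<in> carrier G. inv\<^bsub>G\<^esub> a \<otimes>\<^bsub>G\<^esub> b \<in> V \<longrightarrow> b \<in> ?N e)" if e: "e \<in> {0<..}" for e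
    proof -
      have "e / 2 > 0" using e by simp
      then obtain V where V: "openin ?T V" "\<one>\<^bsub>G\<^esub> \<in> V"
        "\<forall>f \<in> V. \<forall>x \<in> {0..1}. \<bar>f x - x\<bar> < e/2"
        using uniform_ball_contains_homeo_plus_nbhd[of "e/2"] unfolding one by blast
      have "b \<in> ?N e"
        if a: "a \<in> ?N (e/2)" and b: "b \<in> carrier G" and ab: "inv\<^bsub>G\<^esub> a \<otimes>\<^bsub>G\<^esub> b \<in> V" for a b
      proof -
        have "\<bar>(inv\<^bsub>G\<^esub> b) y - half_collapse y\<bar> < e" if y: "y \<in> {0..1}" for y
        proof -
          have bh: "b \<in> homeo_plus" and ah: "a \<in> homeo_plus" using a b by (auto simp: carrier)
          have x: "(inv\<^bsub>G\<^esub> b) y \<in> {0..1}" using homeo_plus_maps[OF inv_mem[OF bh] y] .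
          have "(inv\<^bsub>G\<^esub> a \<otimes>\<^bsub>G\<^esub> b) ((inv\<^bsub>G\<^esub> b) y) = (inv\<^bsub>G\<^esub> a) y"
            using mult[OF inv_mem[OF ah] bh x] inv_apply(2)[OF bh y] by simp
          moreover have "\<bar>(inv\<^bsub>G\<^esub> a \<otimes>\<^bsub>G\<^esub> b) ((inv\<^bsub>G\<^esub> b) y) - (inv\<^bsub>G\<^esub> b) y\<bar> < e/2"
            using bspec[OF bspec[OF V(3) ab] x] .
          moreover have "\<bar>(inv\<^bsub>G\<^esub> a) y - half_collapse y\<bar> < e/2" using a y by blast
          ultimately show ?thesis by linarith
        qed
        then show ?thesis using b by (simp add: carrier)
      qed
      then show ?thesis using V(1,2) \<open>e / 2 > 0\<close>
        by (intro bexI[of _ "e/2"] exI[of _ V] conjI ballI impI) (simp_all only: greaterThan_iff)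
    qed
    show "range half_squeeze \<subseteq> carrier G" using half_squeeze_homeo_plus by (auto simp: carrier)
    show "\<exists>j \<in> {0<..}. \<forall>h \<in> ?N j. g \<otimes>\<^bsub>G\<^esub> h \<in> ?N e" if g: "g \<in> range half_squeeze" and e: "e \<in> {0<..}" for g e
    proof -
      obtain m where m: "g = half_squeeze m" using g by blast
      have gh: "g \<in> homeo_plus" using half_squeeze_homeo_plus m by simp
      have "g \<otimes>\<^bsub>G\<^esub> h \<in> ?N e" if h: "h \<in> ?N e" for h
      proof -
        have hh: "h \<in> homeo_plus" using h by blast
        have "\<bar>(inv\<^bsub>G\<^esub> (g \<otimes>\<^bsub>G\<^esub> h)) y - half_collapse y\<bar> < e" if y: "y \<in> {0..1}" for y
        proof -
          have x: "(inv\<^bsub>G\<^esub> g) y \<in> {0..1}" using homeo_plus_maps[OF inv_mem[OF gh] y] .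
          have "inv\<^bsub>G\<^esub> (g \<otimes>\<^bsub>G\<^esub> h) = inv\<^bsub>G\<^esub> h \<otimes>\<^bsub>G\<^esub> inv\<^bsub>G\<^esub> g"
            using gh hh by (intro inv_mult_group) (auto simp: carrier)
          then have "(inv\<^bsub>G\<^esub> (g \<otimes>\<^bsub>G\<^esub> h)) y = (inv\<^bsub>G\<^esub> h) ((inv\<^bsub>G\<^esub> g) y)"
            using mult[OF inv_mem[OF hh] inv_mem[OF gh] y] by simp
          moreover have "half_collapse ((inv\<^bsub>G\<^esub> g) y) = half_collapse y"
            using half_collapse_half_squeeze[OF x, of m] inv_apply(2)[OF gh y] m by simp
          moreover have "\<bar>(inv\<^bsub>G\<^esub> h) ((inv\<^bsub>G\<^esub> g) y) - half_collapse ((inv\<^bsub>G\<^esub> g) y)\<bar> < e"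
            using h x by blast
          ultimately show ?thesis by simp
        qed
        then show ?thesis using mult_mem gh hh by simp
      qed
      then show ?thesis using e by blast
    qed
    show "\<not> range half_squeeze \<subseteq> K" if "compactin ?T K" for K
      by (rule half_squeezes_not_in_compact[OF that])
  qed
  then show ?thesis unfolding G_def by blast
qed

section \<open>No proper or free isometric actions\<close>

lemma stabilized_limit_consequences:
  assumes "\<exists>(I :: 'i set) N D. noncompactly_stabilized_limit G T I N D"
  shows "has_noncompact_stabilizer G T \<and> no_proper_or_free_isometric_action G T TYPE('x) \<and>
    no_proper_or_free_affine_isometric_action G T TYPE('v::banach)"
proof -
  obtain I :: "'i set" and N D where "noncompactly_stabilized_limit G T I N D" using assms by blast
  then interpret noncompactly_stabilized_limit G T I N D .
  show ?thesis using noncompact_stabilizer no_proper_or_free no_proper_or_free_affine by blast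
qed

theorem theorem7p9:
  shows
    "(has_noncompact_stabilizer unitary_group unitary_strong_topology \<and>
      no_proper_or_free_isometric_action unitary_group unitary_strong_topology TYPE('x) \<and>
      no_proper_or_free_affine_isometric_action unitary_group unitary_strong_topology
        TYPE('v::banach)) \<and>
     (has_noncompact_stabilizer sym_omega sym_omega_topology \<and>
      no_proper_or_free_isometric_action sym_omega sym_omega_topology TYPE('x) \<and>
      no_proper_or_free_affine_isometric_action sym_omega sym_omega_topology
        TYPE('v::banach)) \<and>
     (\<forall>U :: 'u metric. urysohn_sphere U \<longrightarrow>
      has_noncompact_stabilizer (isometry_group U) (isometry_topology U) \<and>
      no_proper_or_free_isometric_action (isometry_group U) (isometry_topology U) TYPE('x) \<and>
      no_proper_or_free_affine_isometric_action (isometry_group U) (isometry_topology U)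
        TYPE('v::banach)) \<and>
     (has_noncompact_stabilizer homeo_plus_group homeo_plus_topology \<and>
      no_proper_or_free_isometric_action homeo_plus_group homeo_plus_topology TYPE('x) \<and>
      no_proper_or_free_affine_isometric_action homeo_plus_group homeo_plus_topology
        TYPE('v::banach))"
  using stabilized_limit_consequences[OF unitary_stabilized_limit, where 'x = 'x and 'v = 'v]
    stabilized_limit_consequences[OF sym_omega_stabilized_limit, where 'x = 'x and 'v = 'v]
    stabilized_limit_consequences[OF urysohn_sphere_stabilized_limit[where 'u = 'u], where 'x = 'x and 'v = 'v]
    stabilized_limit_consequences[OF homeo_plus_stabilized_limit, where 'x = 'x and 'v = 'v]
  by (intro conjI allI impI; simp)

end
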